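(* Let $p \geq 2$ be an integer, fix scalars $c_0 > 0$, $u_0 > 0$ with $u_0 \neq 1$, and $\alpha \geq 0$, and fix an interval $X_0 \subset \mathbb{R}$ of positive length. The following are equivalent: \begin{enumerate} \item For every interval $X \subset \mathbb{R}$ of positive length and every continuous $\mathrm{TN}_p$ Hankel kernel $H : X \times X \to \mathbb{R}$, the kernel $H^\alpha$ (i.e. $(x,y)\mapsto H(x,y)^\alpha$) is $\mathrm{TN}_p$. \item The kernel $H_{u_0} : X_0 \times X_0 \to \mathbb{R}$, $(x,y) \mapsto 1 + c_0 u_0^{x+y}$, has the property that $H_{u_0}^\alpha$ is $\mathrm{TN}_p$ on $X_0 \times X_0$. \item $\alpha \in \mathbb{Z}^{\geq 0} \cup [p-2,\infty)$. \end{enumerate} In particular every $\alpha \in \mathbb{Z}^{\geq 0}$ preserves continuous $\mathrm{TN}$ Hankel kernels on such intervals. Moreover, for every $\mathbf{x}, \mathbf{y} \in \operatorname{inc}(X_0,p)$, the matrix $(H_{u_0}(x_j,y_k)^\alpha)_{j,k=1}^p$ is $\mathrm{TP}$ if $\alpha > p-2$, and is not $\mathrm{TN}$ if $\alpha \in (0,p-2)\setminus \mathbb{Z}$.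
   Context: For a totally ordered set $X$ and integer $r \geq 1$, $\operatorname{inc}(X,r)$ denotes the set of $r$-tuples $(x_1,\dots,x_r) \in X^r$ with $x_1 < \cdots < x_r$. For $X,Y \subset \mathbb{R}$, a kernel $K : X \times Y \to \mathbb{R}$ is $\mathrm{TN}_p$ if $\det (K(x_j,y_k))_{j,k=1}^r \geq 0$ for all $1 \leq r \leq p$ and all $\mathbf{x} \in \operatorname{inc}(X,r)$, $\mathbf{y} \in \operatorname{inc}(Y,r)$; $\mathrm{TP}_p$ if all these are $>0$; $\mathrm{TN}$/$\mathrm{TP}$ if this holds for all $p$. A real matrix is $\mathrm{TN}$/$\mathrm{TP}$ if all its minors are $\ge 0$ / $>0$. A kernel $K : X \times X \to \mathbb{R}$ is Hankel if there is a function $f : X + X \to \mathbb{R}$ with $K(x,y) = f(x+y)$ for all $x,y \in X$. Convention: $0^0 := 0$. *)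

theory Defs
  imports Complex_Main "Jordan_Normal_Form.Determinant"
begin

definition pos_interval :: "real set \<Rightarrow> bool" where
  "pos_interval X \<longleftrightarrow> (\<forall>a\<in>X. \<forall>c\<in>X. \<forall>b. a \<le> b \<and> b \<le> c \<longrightarrow> b \<in> X) \<and> (\<exists>a\<in>X. \<exists>b\<in>X. a < b)"

definition inc :: "real set \<Rightarrow> nat \<Rightarrow> (nat \<Rightarrow> real) set" where
  "inc X r = {x. (\<forall>i<r. x i \<in> X) \<and> (\<forall>i j. i < j \<and> j < r \<longrightarrow> x i < x j)}"

definition kmat :: "(real \<Rightarrow> real \<Rightarrow> real) \<Rightarrow> nat \<Rightarrow> (nat \<Rightarrow> real) \<Rightarrow> (nat \<Rightarrow> real) \<Rightarrow> real mat" where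
  "kmat K r x y = mat r r (\<lambda>(j,k). K (x j) (y k))"

definition TN_kernel :: "nat \<Rightarrow> real set \<Rightarrow> real set \<Rightarrow> (real \<Rightarrow> real \<Rightarrow> real) \<Rightarrow> bool" where
  "TN_kernel p X Y K \<longleftrightarrow> (\<forall>r. 1 \<le> r \<and> r \<le> p \<longrightarrow>
      (\<forall>x\<in>inc X r. \<forall>y\<in>inc Y r. det (kmat K r x y) \<ge> 0))"

definition TP_kernel :: "nat \<Rightarrow> real set \<Rightarrow> real set \<Rightarrow> (real \<Rightarrow> real \<Rightarrow> real) \<Rightarrow> bool" where
  "TP_kernel p X Y K \<longleftrightarrow> (\<forall>r. 1 \<le> r \<and> r \<le> p \<longrightarrow>
      (\<forall>x\<in>inc X r. \<forall>y\<in>inc Y r. det (kmat K r x y) > 0))"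

definition TN_kernel_all :: "real set \<Rightarrow> real set \<Rightarrow> (real \<Rightarrow> real \<Rightarrow> real) \<Rightarrow> bool" where
  "TN_kernel_all X Y K \<longleftrightarrow> (\<forall>p. TN_kernel p X Y K)"

definition inc_idx :: "nat \<Rightarrow> nat \<Rightarrow> (nat \<Rightarrow> nat) set" where
  "inc_idx n r = {f. (\<forall>i<r. f i < n) \<and> (\<forall>i j. i < j \<and> j < r \<longrightarrow> f i < f j)}"

definition minor :: "real mat \<Rightarrow> nat \<Rightarrow> (nat \<Rightarrow> nat) \<Rightarrow> (nat \<Rightarrow> nat) \<Rightarrow> real" where
  "minor A r I J = det (mat r r (\<lambda>(a,b). A $$ (I a, J b)))"

definition TN_mat :: "real mat \<Rightarrow> bool" where
  "TN_mat A \<longleftrightarrow> (\<forall>r. 1 \<le> r \<longrightarrow> (\<forall>I\<in>inc_idx (dim_row A) r. \<forall>J\<in>inc_idx (dim_col A) r. minor A r I J \<ge> 0))"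

definition TP_mat :: "real mat \<Rightarrow> bool" where
  "TP_mat A \<longleftrightarrow> (\<forall>r. 1 \<le> r \<longrightarrow> (\<forall>I\<in>inc_idx (dim_row A) r. \<forall>J\<in>inc_idx (dim_col A) r. minor A r I J > 0))"

definition hankel :: "real set \<Rightarrow> (real \<Rightarrow> real \<Rightarrow> real) \<Rightarrow> bool" where
  "hankel X K \<longleftrightarrow> (\<exists>f. \<forall>x\<in>X. \<forall>y\<in>X. K x y = f (x + y))"

definition kernel_continuous :: "real set \<Rightarrow> (real \<Rightarrow> real \<Rightarrow> real) \<Rightarrow> bool" where
  "kernel_continuous X K \<longleftrightarrow> continuous_on (X \<times> X) (\<lambda>(x,y). K x y)"

text \<open>Entrywise real power; Isabelle's powr has \<open>0 powr a = 0\<close>, matching the convention \<open>0^0 = 0\<close>.\<close>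
definition kpow :: "(real \<Rightarrow> real \<Rightarrow> real) \<Rightarrow> real \<Rightarrow> real \<Rightarrow> real \<Rightarrow> real" where
  "kpow K \<alpha> = (\<lambda>x y. K x y powr \<alpha>)"

definition Hu :: "real \<Rightarrow> real \<Rightarrow> real \<Rightarrow> real \<Rightarrow> real" where
  "Hu c u = (\<lambda>x y. 1 + c * u powr (x + y))"

end

theory Submission
  imports Defs
begin

text \<open>
  Dividing the rows of a determinant by their first entries and subtracting consecutive rows lowers
  its order by one. For the kernel \<open>(1 + c u\<^bsup>x+y\<^esup>)\<^bsup>\<alpha>\<^esup>\<close> and the mean value theorem this turns an
  \<open>n\<close>-minor with exponent \<open>\<alpha>\<close> into a positive multiple of \<open>\<alpha>\<^bsup>n-1\<^esup>\<close> times an \<open>(n-1)\<close>-minor with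
  exponent \<open>\<alpha> - 1\<close>, so its sign is that of \<open>\<Prod>\<^bsub>k<n\<^esub> (\<alpha> - k)\<^bsup>n-1-k\<^esup>\<close>. For a matrix, with telescoping sums in place
  of the mean value theorem, it gives Fekete's criterion: positive contiguous minors imply
  that all minors are positive.

  On an equally spaced grid the contiguous submatrices of a Hankel kernel are symmetric matrices
  \<open>(K(z\<^sub>i, z\<^sub>j))\<close>. After a small perturbation making these positive definite, Fekete's criterion and
  continuity show that a continuous Hankel kernel is \<open>TN\<^sub>p\<close> iff all \<open>(K(z\<^sub>i, z\<^sub>j))\<close> of size at most \<open>p\<close>
  are positive semidefinite. Powers preserve the latter by the Schur product theorem (integer
  exponents) and the FitzGerald-Horn theorem (exponents \<open>\<alpha> \<ge> p - 2\<close>), which needs positive entries: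
  a continuous \<open>TN\<^sub>2\<close> Hankel kernel with a zero vanishes identically.
\<close>

subsection \<open>Determinants\<close>

definition fdet :: "nat \<Rightarrow> (nat \<Rightarrow> nat \<Rightarrow> real) \<Rightarrow> real" where
  "fdet n A = det (mat n n (\<lambda>(i,j). A i j))"

lemma fdet_cong:
  assumes "\<And>i j. i < n \<Longrightarrow> j < n \<Longrightarrow> A i j = B i j"
  shows "fdet n A = fdet n B"
  unfolding fdet_def by (rule arg_cong[of _ _ det], rule eq_matI) (use assms in auto)

lemma fdet_0 [simp]: "fdet 0 A = 1"
  by (simp add: fdet_def)

lemma fdet_1: "fdet (Suc 0) A = A 0 0"
  unfolding fdet_def by (subst det_single) auto

lemma fdet_2: "fdet 2 A = A 0 0 * A 1 1 - A 0 1 * A 1 0"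
proof -
  let ?M = "mat 2 2 (\<lambda>(i,j). A i j)"
  have "fdet 2 A = (\<Sum>j<2. ?M $$ (0,j) * cofactor ?M 0 j)"
    unfolding fdet_def by (rule laplace_expansion_row) auto
  moreover have "det (mat_delete ?M 0 0) = A 1 1" "det (mat_delete ?M 0 1) = A 1 0"
    by (subst det_single; simp add: mat_delete_def)+
  ultimately show ?thesis
    by (simp add: cofactor_def numeral_2_eq_2)
qed

lemma fdet_transpose: "fdet n (\<lambda>i j. A j i) = fdet n A"
proof -
  have "mat n n (\<lambda>(i,j). A j i) = (mat n n (\<lambda>(i,j). A i j))\<^sup>T"
    by (rule eq_matI) auto
  then show ?thesis
    unfolding fdet_def by (metis det_transpose mat_carrier)
qed

lemma fdet_expand:
  "fdet n A = (\<Sum>p | p permutes {0..<n}. signof p * (\<Prod>i = 0..<n. A i (p i)))"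
proof -
  have "(\<Prod>i = 0..<n. mat n n (\<lambda>(i,j). A i j) $$ (i, p i)) = (\<Prod>i = 0..<n. A i (p i))"
    if "p permutes {0..<n}" for p
    by (rule prod.cong) (use that permutes_in_image[OF that] in auto)
  then show ?thesis
    unfolding fdet_def by (subst det_def'[of _ n]) auto
qed

lemma fdet_scale: "fdet n (\<lambda>i j. a i * b j * A i j) = (\<Prod>i<n. a i) * (\<Prod>j<n. b j) * fdet n A"
proof -
  have "(\<Prod>i = 0..<n. a i * b (p i) * A i (p i))
      = (\<Prod>i<n. a i) * (\<Prod>j<n. b j) * (\<Prod>i = 0..<n. A i (p i))" if "p permutes {0..<n}" for p
  proof -
    have "(\<Prod>i = 0..<n. b (p i)) = (\<Prod>i = 0..<n. b i)"
      using prod.permute[OF that, of b] by (simp add: o_def)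
    then show ?thesis
      by (simp add: prod.distrib atLeast0LessThan)
  qed
  then show ?thesis
    unfolding fdet_expand sum_distrib_left by (intro sum.cong) (auto simp: mult_ac)
qed

lemma tendsto_fdet:
  assumes "\<And>i j. i < n \<Longrightarrow> j < n \<Longrightarrow> ((\<lambda>t. A t i j) \<longlongrightarrow> B i j) F"
  shows "((\<lambda>t. fdet n (A t)) \<longlongrightarrow> fdet n B) F"
  unfolding fdet_expand
proof (intro tendsto_sum tendsto_mult tendsto_const tendsto_prod)
  fix p i assume "p \<in> {p. p permutes {0..<n}}" and i: "i \<in> {0..<n}"
  then have "p i < n" using permutes_in_image[of p "{0..<n}" i] by auto
  then show "((\<lambda>t. A t i (p i)) \<longlongrightarrow> B i (p i)) F"
    using assms i by auto
qed

section \<open>Determinants as functions of a single row\<close>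

lemma fdet_row_functional:
  assumes k: "k < n"
  shows "\<exists>c. \<forall>w. fdet n (v(k := w)) = (\<Sum>j<n. c j * w j)"
proof -
  \<comment> \<open>The cofactors along row \<open>k\<close> do not see row \<open>k\<close>, so
    these coefficients serve every \<open>w\<close> at once.\<close>
  define c where "c j = cofactor (mat n n (\<lambda>(i,j). v i j)) k j" for j
  have "fdet n (v(k := w)) = (\<Sum>j<n. c j * w j)" for w
  proof -
    have "mat_delete (mat n n (\<lambda>(i,j). (v(k := w)) i j)) k j
        = mat_delete (mat n n (\<lambda>(i,j). v i j)) k j" if "j < n" for j
      unfolding mat_delete_def by (rule eq_matI) (use k that in auto)
    then have "cofactor (mat n n (\<lambda>(i,j). (v(k := w)) i j)) k j = c j" if "j < n" for j
      unfolding cofactor_def c_def by (simp only: that)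
    then show ?thesis
      unfolding fdet_def
      by (subst laplace_expansion_row[OF _ k]) (use k in \<open>auto simp: mult.commute intro!: sum.cong simp del: fun_upd_apply\<close>, simp)
  qed
  then show ?thesis by blast
qed

text \<open>\<open>w i\<close> need not lie in the cone spanned by \<open>S i\<close>; it suffices that no linear functional separates
  them, which is what the mean value theorem provides.\<close>
lemma fdet_pos_rowwise:
  assumes pos: "\<And>v. (\<And>i. i < n \<Longrightarrow> v i \<in> S i) \<Longrightarrow> 0 < \<sigma> * fdet n v"
    and dom: "\<And>i c. i < n \<Longrightarrow> (\<And>s. s \<in> S i \<Longrightarrow> 0 < (\<Sum>j<n. c j * s j)) \<Longrightarrow> 0 < (\<Sum>j<n. c j * w i j)"
  shows "0 < \<sigma> * fdet n w"
proof -
  \<comment> \<open>Rows are exchanged one at a time: the first \<open>k\<close> are already rows of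
    \<open>w\<close>, the others arbitrary members of their sets. As a function of row
    \<open>k\<close> the determinant is linear and of sign \<open>\<sigma>\<close> on
    \<open>S k\<close>, so \<open>dom\<close> carries the sign over to \<open>w k\<close>.\<close>
  have "0 < \<sigma> * fdet n v"
    if "k \<le> n" "\<And>i. i < k \<Longrightarrow> v i = w i" "\<And>i. k \<le> i \<Longrightarrow> i < n \<Longrightarrow> v i \<in> S i" for k v
    using that
  proof (induction k arbitrary: v)
    case 0
    then show ?case using pos by auto
  next
    case (Suc k)
    then have k: "k < n" by simp
    obtain c where c: "\<And>u. fdet n (v(k := u)) = (\<Sum>j<n. c j * u j)"
      using fdet_row_functional[OF k] by blast
    have "0 < (\<Sum>j<n. (\<sigma> * c j) * s j)" if "s \<in> S k" for s
    proof -
      have "0 < \<sigma> * fdet n (v(k := s))"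
        by (rule Suc.IH) (use Suc.prems that in auto)
      then show ?thesis
        by (simp add: c sum_distrib_left mult.assoc)
    qed
    then have "0 < (\<Sum>j<n. (\<sigma> * c j) * w k j)"
      by (rule dom[OF k])
    then have "0 < \<sigma> * fdet n (v(k := w k))"
      by (simp add: c sum_distrib_left mult.assoc)
    then show ?case
      using Suc.prems(2)[of k] by (metis fun_upd_triv lessI)
  qed
  from this[of n w] show ?thesis by simp
qed

section \<open>Reducing the order of a determinant\<close>

lemma fdet_first_column:
  assumes "\<And>i. 0 < i \<Longrightarrow> i \<le> n \<Longrightarrow> B i 0 = 0"
  shows "fdet (Suc n) B = B 0 0 * fdet n (\<lambda>i j. B (Suc i) (Suc j))"
proof -
  let ?M = "mat (Suc n) (Suc n) (\<lambda>(i,j). B i j)"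
  have "fdet (Suc n) B = (\<Sum>i<Suc n. ?M $$ (i,0) * cofactor ?M i 0)"
    unfolding fdet_def by (rule laplace_expansion_column) auto
  also have "\<dots> = (\<Sum>i<Suc n. if i = 0 then B 0 0 * cofactor ?M 0 0 else 0)"
    by (rule sum.cong) (use assms in auto)
  also have "\<dots> = B 0 0 * cofactor ?M 0 0" by simp
  also have "cofactor ?M 0 0 = fdet n (\<lambda>i j. B (Suc i) (Suc j))"
    unfolding cofactor_def fdet_def mat_delete_def
    by (simp, rule arg_cong[of _ _ det], rule eq_matI) auto
  finally show ?thesis .
qed

text \<open>All rows change at once and refer to the original rows, so this is left multiplication
  by a unit lower triangular matrix. The choices \<open>\<pi> i = 0\<close> and
  \<open>\<pi> i = i - 1\<close> give the two reductions of order that follow.\<close>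

lemma fdet_row_ops:
  assumes "\<And>i. 0 < i \<Longrightarrow> i < n \<Longrightarrow> \<pi> i < i"
  shows "fdet n (\<lambda>i j. if i = 0 then A 0 j else A i j - m i * A (\<pi> i) j) = fdet n A"
proof -
  define L where "L = mat n n (\<lambda>(i,k). if i = k then 1 else if 0 < i \<and> k = \<pi> i then - m i else (0::real))"
  let ?A = "mat n n (\<lambda>(i,j). A i j)"
  have L: "L \<in> carrier_mat n n" by (simp add: L_def)
  have "det L = prod_list (diag_mat L)"
  proof (rule det_lower_triangular[OF _ L])
    fix i j :: nat assume "i < j" "j < n"
    then show "L $$ (i,j) = 0"
      using assms[of i] by (cases "0 < i") (simp_all add: L_def)
  qed
  also have "\<dots> = 1"
    unfolding prod_list_diag_prod by (rule prod.neutral) (auto simp: L_def)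
  finally have detL: "det L = 1" .
  have "mat n n (\<lambda>(i,j). if i = 0 then A 0 j else A i j - m i * A (\<pi> i) j) = L * ?A"
  proof (rule eq_matI)
    fix i j assume "i < dim_row (L * ?A)" "j < dim_col (L * ?A)"
    then have i: "i < n" and j: "j < n" using L by auto
    have "(L * ?A) $$ (i,j) = (\<Sum>k<n. L $$ (i,k) * A k j)"
      using i j L by (auto simp: times_mat_def scalar_prod_def atLeast0LessThan intro!: sum.cong)
    also have "\<dots> = (\<Sum>k<n. (if k = i then A i j else 0) + (if k = \<pi> i \<and> 0 < i then - m i * A (\<pi> i) j else 0))"
    proof (rule sum.cong)
      fix k assume "k \<in> {..<n}"
      then show "L $$ (i,k) * A k j = (if k = i then A i j else 0) + (if k = \<pi> i \<and> 0 < i then - m i * A (\<pi> i) j else 0)"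
        using i assms[of i] by (cases "k = i"; cases "0 < i") (auto simp: L_def)
    qed simp
    also have "\<dots> = A i j + (if 0 < i then - m i * A (\<pi> i) j else 0)"
    proof (cases "0 < i")
      case True
      then have "\<pi> i < n" using i assms[of i] by simp
      then show ?thesis using i True by (simp add: sum.distrib)
    qed (use i in \<open>simp add: sum.distrib\<close>)
    finally show "mat n n (\<lambda>(i,j). if i = 0 then A 0 j else A i j - m i * A (\<pi> i) j) $$ (i,j) = (L * ?A) $$ (i,j)"
      using i j by simp
  qed (use L in auto)
  then show ?thesis
    unfolding fdet_def using det_mult[OF L, of ?A] detL by simp
qed

text \<open>One step of Gaussian elimination with pivot \<open>A 0 0\<close> (Chio's condensation);
  the remaining entries form the Schur complement.\<close>

lemma fdet_chio:
  assumes "A 0 0 \<noteq> 0"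
  shows "fdet (Suc n) A = A 0 0 * fdet n (\<lambda>i j. A (Suc i) (Suc j) - A (Suc i) 0 * A 0 (Suc j) / A 0 0)"
proof -
  let ?B = "\<lambda>i j. if i = 0 then A 0 j else A i j - A i 0 / A 0 0 * A 0 j"
  have "fdet (Suc n) A = fdet (Suc n) ?B"
    using fdet_row_ops[of "Suc n" "\<lambda>_. 0" A "\<lambda>i. A i 0 / A 0 0"] by simp
  also have "\<dots> = ?B 0 0 * fdet n (\<lambda>i j. ?B (Suc i) (Suc j))"
    by (rule fdet_first_column) (use assms in auto)
  finally show ?thesis by simp
qed

text \<open>Once each row is divided by its first entry, column 0 is constantly 1, and differences
  of consecutive rows clear it below the top.\<close>

lemma fdet_divided_differences:
  assumes "\<And>i. i \<le> n \<Longrightarrow> A i 0 \<noteq> 0"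
  shows "fdet (Suc n) A = (\<Prod>i\<le>n. A i 0) *
    fdet n (\<lambda>i j. A (Suc i) (Suc j) / A (Suc i) 0 - A i (Suc j) / A i 0)"
proof -
  let ?A = "\<lambda>i j. A i j / A i 0"
  let ?B = "\<lambda>i j. if i = 0 then ?A 0 j else ?A i j - ?A (i - 1) j"
  have "fdet (Suc n) A = fdet (Suc n) (\<lambda>i j. A i 0 * 1 * ?A i j)"
    by (rule fdet_cong) (use assms in auto)
  also have "\<dots> = (\<Prod>i<Suc n. A i 0) * fdet (Suc n) ?A"
    by (subst fdet_scale) simp
  also have "fdet (Suc n) ?A = fdet (Suc n) ?B"
    using fdet_row_ops[of "Suc n" "\<lambda>i. i - 1" ?A "\<lambda>_. 1", symmetric] by (simp only: mult_1)
  also have "\<dots> = ?B 0 0 * fdet n (\<lambda>i j. ?B (Suc i) (Suc j))"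
    by (rule fdet_first_column) (use assms in auto)
  finally show ?thesis
    using assms[of 0] by (simp add: lessThan_Suc_atMost)
qed

subsection \<open>The sign of the minors of the Jain-Karlin-Schoenberg kernel\<close>

text \<open>The recursion mirrors the reduction of a minor: passing from order \<open>Suc n\<close>
  to \<open>n\<close> pulls \<open>\<alpha>\<close> out of each of the \<open>n\<close> rows and
  lowers the exponent by one.\<close>

fun jain_sign :: "nat \<Rightarrow> real \<Rightarrow> real" where
  "jain_sign 0 \<alpha> = 1"
| "jain_sign (Suc n) \<alpha> = \<alpha> ^ n * jain_sign n (\<alpha> - 1)"

text \<open>In the product of the powers \<open>(\<alpha> - k) ^ (n - 1 - k)\<close> only factors
  with \<open>k \<le> n - 2\<close> have a positive exponent, and their bases are all
  positive.\<close>

lemma jain_sign_pos: "real n - 2 < \<alpha> \<Longrightarrow> 0 < jain_sign n \<alpha>"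
proof (induction n arbitrary: \<alpha>)
  case (Suc n)
  then have "0 < jain_sign n (\<alpha> - 1)" by simp
  moreover have "0 < \<alpha> ^ n" using Suc.prems by (cases n) auto
  ultimately show ?case by simp
qed simp

text \<open>Among the factors with positive exponent exactly one base is negative, that for
  \<open>k = n - 2\<close>, and its exponent is 1.\<close>

lemma jain_sign_neg: "2 \<le> n \<Longrightarrow> real n - 3 < \<alpha> \<Longrightarrow> \<alpha> < real n - 2 \<Longrightarrow> jain_sign n \<alpha> < 0"
proof (induction n arbitrary: \<alpha> rule: dec_induct)
  case base
  then show ?case by (simp add: numeral_2_eq_2)
next
  case (step n)
  then have "jain_sign n (\<alpha> - 1) < 0" by simp
  moreover have "0 < \<alpha> ^ n" using step by simp
  ultimately show ?case by (simp add: mult_pos_neg)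
qed

text \<open>The derivative separates into a factor in \<open>\<xi>\<close> and \<open>a\<close>, a
  factor in \<open>a\<close> and \<open>b\<close>, and the kernel itself at \<open>\<xi> + b\<close>
  with exponent \<open>\<alpha> - 1\<close>. With \<open>a\<close> fixed, the first two are row and
  column scalings of a determinant.\<close>

lemma has_derivative_quotient_powr:
  fixes c s :: real
  assumes c: "0 < c"
  defines "E \<equiv> \<lambda>z. 1 + c * exp (s * z)"
  shows "((\<lambda>\<xi>. E (\<xi> + b) powr \<alpha> / E (\<xi> + a) powr \<alpha>) has_real_derivative
     (\<alpha> * (c * exp (s * \<xi>) / E (\<xi> + a) powr (\<alpha> + 1))) * (s * (exp (s * b) - exp (s * a))) * E (\<xi> + b) powr (\<alpha> - 1)) (at \<xi>)"
proof -
  have E: "0 < E z" for z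
    unfolding E_def using c by (intro add_pos_pos mult_pos_pos) auto
  have dE: "((\<lambda>\<xi>. E (\<xi> + t)) has_real_derivative c * s * exp (s * (\<xi> + t))) (at \<xi>)" for t
    unfolding E_def by (auto intro!: derivative_eq_intros)
  have d: "((\<lambda>\<xi>. E (\<xi> + t) powr \<beta>) has_real_derivative
      \<beta> * E (\<xi> + t) powr (\<beta> - 1) * (c * s * exp (s * (\<xi> + t)))) (at \<xi>)" for t \<beta>
    using DERIV_fun_powr[OF dE[of t] E[of "\<xi> + t"], of \<beta>] by simp
  define P where "P = E (\<xi> + b) powr (\<alpha> - 1)"
  define R where "R = E (\<xi> + a) powr \<alpha>"
  have P: "E (\<xi> + b) powr \<alpha> = P * E (\<xi> + b)"
    unfolding P_def using E[of "\<xi> + b"] by (simp add: powr_diff)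
  have R1: "E (\<xi> + a) powr (\<alpha> + 1) = R * E (\<xi> + a)"
    unfolding R_def using E[of "\<xi> + a"] by (simp add: powr_add)
  have R2: "E (\<xi> + a) powr (\<alpha> - 1) = R / E (\<xi> + a)"
    unfolding R_def using E[of "\<xi> + a"] by (simp add: powr_diff)
  have R: "0 < R" unfolding R_def using E[of "\<xi> + a"] by simp
  have "((\<lambda>\<xi>. E (\<xi> + b) powr \<alpha> / E (\<xi> + a) powr \<alpha>) has_real_derivative
     ((\<alpha> * P * (c * s * exp (s * (\<xi> + b)))) * R
       - (P * E (\<xi> + b)) * (\<alpha> * (R / E (\<xi> + a)) * (c * s * exp (s * (\<xi> + a))))) / (R * R)) (at \<xi>)"
    using DERIV_divide[OF d[of b \<alpha>] d[of a \<alpha>]] R unfolding P_def[symmetric] R_def[symmetric] P R2 by auto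
  moreover have "((\<alpha> * P * (c * s * exp (s * (\<xi> + b)))) * R
       - (P * E (\<xi> + b)) * (\<alpha> * (R / E (\<xi> + a)) * (c * s * exp (s * (\<xi> + a))))) / (R * R)
     = \<alpha> * P * c * s * (exp (s * (\<xi> + b)) * E (\<xi> + a) - exp (s * (\<xi> + a)) * E (\<xi> + b)) / (R * E (\<xi> + a))"
    using R E[of "\<xi> + a"] by (simp add: field_simps)
  \<comment> \<open>The products of two exponentials cancel, so \<open>\<xi>\<close> separates from
    \<open>a\<close> and \<open>b\<close>.\<close>
  moreover have "exp (s * (\<xi> + b)) * E (\<xi> + a) - exp (s * (\<xi> + a)) * E (\<xi> + b)
      = exp (s * \<xi>) * (exp (s * b) - exp (s * a))"
    unfolding E_def by (simp add: algebra_simps exp_add)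
  ultimately show ?thesis
    unfolding R1 P_def[symmetric] by (simp add: mult_ac)
qed

text \<open>The free multiplier \<open>\<sigma>\<close> lets a single induction treat both signs:
  each reduction of order moves the factor \<open>\<alpha> ^ n\<close> into it.\<close>

lemma jain_determinant:
  fixes c s :: real
  assumes c: "0 < c" and s: "s \<noteq> 0"
  shows "strict_mono_on {..<n} x \<Longrightarrow> strict_mono_on {..<n} y \<Longrightarrow> 0 < \<sigma> * jain_sign n \<alpha> \<Longrightarrow>
    0 < \<sigma> * fdet n (\<lambda>i k. (1 + c * exp (s * (x i + y k))) powr \<alpha>)"
proof (induction n arbitrary: x y \<sigma> \<alpha>)
  case (Suc n)
  define E where "E = (\<lambda>z. 1 + c * exp (s * z))"
  have E: "0 < E z" for z
    unfolding E_def using c by (intro add_pos_pos mult_pos_pos) auto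
  have xm: "x i < x j" if "i < j" "j \<le> n" for i j
    using strict_mono_onD[OF Suc.prems(1)] that by simp
  have ym: "y i < y j" if "i < j" "j \<le> n" for i j
    using strict_mono_onD[OF Suc.prems(2)] that by simp
  define F where "F = (\<lambda>j \<xi>. E (\<xi> + y (Suc j)) powr \<alpha> / E (\<xi> + y 0) powr \<alpha>)"
  define \<rho> where "\<rho> = (\<lambda>\<xi>. c * exp (s * \<xi>) / E (\<xi> + y 0) powr (\<alpha> + 1))"
  define \<kappa> where "\<kappa> = (\<lambda>j. s * (exp (s * y (Suc j)) - exp (s * y 0)))"
  define F' where "F' = (\<lambda>\<xi> j. (\<alpha> * \<rho> \<xi>) * \<kappa> j * E (\<xi> + y (Suc j)) powr (\<alpha> - 1))"
  have dF: "(F j has_real_derivative F' \<xi> j) (at \<xi>)" for j \<xi>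
    unfolding F_def F'_def \<rho>_def \<kappa>_def E_def by (rule has_derivative_quotient_powr[OF c])
  have \<rho>: "0 < \<rho> \<xi>" for \<xi> unfolding \<rho>_def using c E[of "\<xi> + y 0"] by simp
  \<comment> \<open>The factor \<open>s\<close> and the difference of exponentials have the same
    sign, since \<open>y\<close> increases.\<close>
  have \<kappa>: "0 < \<kappa> j" if "j < n" for j
    unfolding \<kappa>_def using ym[of 0 "Suc j"] that s
    by (cases "0 < s") (auto intro!: mult_neg_neg)
  \<comment> \<open>Each row of increments is compared with the rows of derivatives at points
    strictly between \<open>x i\<close> and \<open>x (Suc i)\<close>.\<close>
  have "0 < \<sigma> * fdet n (\<lambda>i j. F j (x (Suc i)) - F j (x i))"
  proof (rule fdet_pos_rowwise[where S = "\<lambda>i. F' ` {x i<..<x (Suc i)}"])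
    fix v assume "\<And>i. i < n \<Longrightarrow> v i \<in> F' ` {x i<..<x (Suc i)}"
    then have "\<forall>i. \<exists>\<xi>. i < n \<longrightarrow> x i < \<xi> \<and> \<xi> < x (Suc i) \<and> v i = F' \<xi>"
      by (metis (no_types, lifting) greaterThanLessThan_iff imageE)
    then obtain \<xi> where \<xi>: "\<And>i. i < n \<Longrightarrow> x i < \<xi> i \<and> \<xi> i < x (Suc i) \<and> v i = F' (\<xi> i)"
      by metis
    \<comment> \<open>The points come from consecutive disjoint intervals, so they form an
      increasing tuple to which the induction hypothesis applies.\<close>
    have mono: "strict_mono_on {..<n} \<xi>"
    proof (rule strict_mono_onI)
      fix i j assume ij: "i \<in> {..<n}" "j \<in> {..<n}" "i < j"
      have "\<xi> i < x (Suc i)" using \<xi> ij by auto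
      also have "x (Suc i) \<le> x j" using xm[of "Suc i" j] ij by (cases "Suc i = j") auto
      also have "x j < \<xi> j" using \<xi> ij by auto
      finally show "\<xi> i < \<xi> j" .
    qed
    have "fdet n v = fdet n (\<lambda>i j. (\<alpha> * \<rho> (\<xi> i)) * \<kappa> j * E (\<xi> i + y (Suc j)) powr (\<alpha> - 1))"
      by (rule fdet_cong) (use \<xi> in \<open>simp add: F'_def\<close>)
    also have "\<dots> = \<alpha> ^ n * ((\<Prod>i<n. \<rho> (\<xi> i)) * (\<Prod>j<n. \<kappa> j)) * fdet n (\<lambda>i j. E (\<xi> i + y (Suc j)) powr (\<alpha> - 1))"
      by (simp add: fdet_scale prod.distrib)
    finally have eq: "\<sigma> * fdet n v = ((\<Prod>i<n. \<rho> (\<xi> i)) * (\<Prod>j<n. \<kappa> j)) *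
        ((\<sigma> * \<alpha> ^ n) * fdet n (\<lambda>i j. E (\<xi> i + y (Suc j)) powr (\<alpha> - 1)))"
      by simp
    have "0 < (\<sigma> * \<alpha> ^ n) * fdet n (\<lambda>i j. E (\<xi> i + y (Suc j)) powr (\<alpha> - 1))"
      unfolding E_def using Suc.IH[OF mono, of "\<lambda>j. y (Suc j)" "\<sigma> * \<alpha> ^ n" "\<alpha> - 1"] Suc.prems(3)
      by (simp add: strict_mono_on_def ym mult.assoc)
    moreover have "0 < (\<Prod>i<n. \<rho> (\<xi> i)) * (\<Prod>j<n. \<kappa> j)"
      using \<rho> \<kappa> by (intro mult_pos_pos prod_pos) auto
    ultimately show "0 < \<sigma> * fdet n v"
      unfolding eq by (rule mult_pos_pos[rotated])
  next
    fix i d assume i: "i < n" and d: "\<And>r. r \<in> F' ` {x i<..<x (Suc i)} \<Longrightarrow> 0 < (\<Sum>j<n. d j * r j)"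
    \<comment> \<open>The entries of a row need not share an intermediate point, so the mean value
      theorem is applied to the scalar function that the functional \<open>d\<close> makes of the
      whole row.\<close>
    have "\<exists>z. x i < z \<and> z < x (Suc i) \<and>
      (\<Sum>j<n. d j * F j (x (Suc i))) - (\<Sum>j<n. d j * F j (x i)) = (x (Suc i) - x i) * (\<Sum>j<n. d j * F' z j)"
      by (rule MVT2) (use i xm in \<open>auto intro!: DERIV_sum DERIV_cmult dF\<close>)
    then obtain z where z: "x i < z" "z < x (Suc i)"
      "(\<Sum>j<n. d j * F j (x (Suc i))) - (\<Sum>j<n. d j * F j (x i)) = (x (Suc i) - x i) * (\<Sum>j<n. d j * F' z j)"
      by blast
    then have "0 < (x (Suc i) - x i) * (\<Sum>j<n. d j * F' z j)"
      by (intro mult_pos_pos d) auto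
    then show "0 < (\<Sum>j<n. d j * (F j (x (Suc i)) - F j (x i)))"
      unfolding z(3)[symmetric] by (simp add: right_diff_distrib sum_subtractf)
  qed
  moreover have "fdet (Suc n) (\<lambda>i k. E (x i + y k) powr \<alpha>)
      = (\<Prod>i\<le>n. E (x i + y 0) powr \<alpha>) * fdet n (\<lambda>i j. F j (x (Suc i)) - F j (x i))"
    unfolding F_def by (rule fdet_divided_differences) (use E in \<open>simp add: less_imp_neq[symmetric]\<close>)
  moreover have "0 < (\<Prod>i\<le>n. E (x i + y 0) powr \<alpha>)"
    using E by (intro prod_pos) (simp add: less_imp_neq[symmetric])
  ultimately have "0 < \<sigma> * fdet (Suc n) (\<lambda>i k. E (x i + y k) powr \<alpha>)"
    by (simp only: mult.left_commute[of \<sigma>]) (rule mult_pos_pos)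
  then show ?case
    unfolding E_def .
qed simp

subsection \<open>Fekete's criterion\<close>

text \<open>Rows are freed first, with the initial block of columns held fixed. In the induction
  \<open>B\<close> plays the role of the derivative: its contiguous minors are those of
  \<open>A\<close>, one order higher, divided by positive entries of column 0, and the increment
  from row \<open>I i\<close> to row \<open>I (Suc i)\<close> is a sum of rows of
  \<open>B\<close>.\<close>

lemma fekete_rows:
  assumes "\<And>k a. k \<le> r \<Longrightarrow> a + k \<le> N \<Longrightarrow> 0 < fdet k (\<lambda>i j. A (a + i) j)"
    and "strict_mono_on {..<r} I" "\<And>i. i < r \<Longrightarrow> I i < N"
  shows "0 < fdet r (\<lambda>i j. A (I i) j)"
  using assms
proof (induction r arbitrary: N A I)
  case (Suc n)
  have A0: "0 < A i 0" if "i < N" for i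
    using Suc.prems(1)[of "Suc 0" i] that by (simp add: fdet_1)
  have Im: "I i < I j" if "i < j" "j \<le> n" for i j
    using strict_mono_onD[OF Suc.prems(2)] that by simp
  define B where "B = (\<lambda>t j. A (Suc t) (Suc j) / A (Suc t) 0 - A t (Suc j) / A t 0)"
  have B: "0 < fdet k (\<lambda>i j. B (a + i) j)" if k: "k \<le> n" "a + k \<le> N - 1" "1 \<le> N" for k a
  proof -
    have pos: "0 < A (a + i) 0" if "i \<le> k" for i using A0 that k by simp
    have "fdet (Suc k) (\<lambda>i j. A (a + i) j) = (\<Prod>i\<le>k. A (a + i) 0) * fdet k (\<lambda>i j. B (a + i) j)"
      unfolding B_def using pos by (subst fdet_divided_differences) (auto simp: less_imp_neq[symmetric])
    moreover have "0 < fdet (Suc k) (\<lambda>i j. A (a + i) j)"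
      by (rule Suc.prems(1)) (use k in auto)
    moreover have "0 < (\<Prod>i\<le>k. A (a + i) 0)" using pos by (intro prod_pos) auto
    ultimately show ?thesis by (simp add: zero_less_mult_iff)
  qed
  have N: "1 \<le> N" using Suc.prems(3)[of 0] by simp
  have "0 < 1 * fdet n (\<lambda>i j. A (I (Suc i)) (Suc j) / A (I (Suc i)) 0 - A (I i) (Suc j) / A (I i) 0)"
  proof (rule fdet_pos_rowwise[where S = "\<lambda>i. B ` {I i..<I (Suc i)}"])
    fix v assume "\<And>i. i < n \<Longrightarrow> v i \<in> B ` {I i..<I (Suc i)}"
    then have "\<forall>i. \<exists>t. i < n \<longrightarrow> I i \<le> t \<and> t < I (Suc i) \<and> v i = B t"
      by (metis (no_types, lifting) atLeastLessThan_iff imageE)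
    then obtain t where t: "\<And>i. i < n \<Longrightarrow> I i \<le> t i \<and> t i < I (Suc i) \<and> v i = B (t i)"
      by metis
    have "strict_mono_on {..<n} t"
    proof (rule strict_mono_onI)
      fix i j assume ij: "i \<in> {..<n}" "j \<in> {..<n}" "i < j"
      have "t i < I (Suc i)" using t ij by auto
      also have "I (Suc i) \<le> I j" using Im[of "Suc i" j] ij by (cases "Suc i = j") auto
      also have "I j \<le> t j" using t ij by auto
      finally show "t i < t j" .
    qed
    \<comment> \<open>Row \<open>t\<close> of \<open>B\<close> uses the rows \<open>t\<close> and
      \<open>t + 1\<close> of \<open>A\<close>, so \<open>B\<close> has one row fewer.\<close>
    moreover have "t i < N - 1" if "i < n" for i
      using t[OF that] Suc.prems(3)[of "Suc i"] that by linarith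
    ultimately have "0 < fdet n (\<lambda>i j. B (t i) j)"
      using Suc.IH[of "N - 1" B t] B N by blast
    moreover have "fdet n v = fdet n (\<lambda>i j. B (t i) j)"
      by (rule fdet_cong) (use t in simp)
    ultimately show "0 < 1 * fdet n v" by simp
  next
    fix i d assume i: "i < n" and d: "\<And>s. s \<in> B ` {I i..<I (Suc i)} \<Longrightarrow> 0 < (\<Sum>j<n. d j * s j)"
    have lt: "I i < I (Suc i)" using Im i by simp
    have "(\<Sum>j<n. d j * (A (I (Suc i)) (Suc j) / A (I (Suc i)) 0 - A (I i) (Suc j) / A (I i) 0))
        = (\<Sum>j<n. d j * (\<Sum>t = I i..<I (Suc i). B t j))"
      unfolding B_def
      using sum_Suc_diff'[of "I i" "I (Suc i)" "\<lambda>t. A t (Suc j) / A t 0" for j] lt by simp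
    also have "\<dots> = (\<Sum>t = I i..<I (Suc i). \<Sum>j<n. d j * B t j)"
      unfolding sum_distrib_left by (rule sum.swap)
    also have "0 < \<dots>" by (rule sum_pos) (use lt d in auto)
    finally show "0 < (\<Sum>j<n. d j * (A (I (Suc i)) (Suc j) / A (I (Suc i)) 0 - A (I i) (Suc j) / A (I i) 0))" .
  qed
  moreover have "fdet (Suc n) (\<lambda>i j. A (I i) j) = (\<Prod>i\<le>n. A (I i) 0) *
      fdet n (\<lambda>i j. A (I (Suc i)) (Suc j) / A (I (Suc i)) 0 - A (I i) (Suc j) / A (I i) 0)"
    by (rule fdet_divided_differences) (use A0 Suc.prems(3) in \<open>simp add: less_imp_neq[symmetric]\<close>)
  moreover have "0 < (\<Prod>i\<le>n. A (I i) 0)"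
    using A0 Suc.prems(3) by (intro prod_pos) auto
  ultimately show ?case by simp
qed simp

text \<open>The row version is applied twice: first with a contiguous block of columns, then to the
  transpose, where the rows chosen by \<open>I\<close> have become the columns.\<close>

theorem fekete:
  assumes contiguous: "\<And>k a b. k \<le> r \<Longrightarrow> a + k \<le> N \<Longrightarrow> b + k \<le> N \<Longrightarrow> 0 < fdet k (\<lambda>i j. A (a + i) (b + j))"
    and I: "strict_mono_on {..<r} I" "\<And>i. i < r \<Longrightarrow> I i < N"
    and J: "strict_mono_on {..<r} J" "\<And>i. i < r \<Longrightarrow> J i < N"
  shows "0 < fdet r (\<lambda>i j. A (I i) (J j))"
proof -
  have "0 < fdet k (\<lambda>i j. A (I j) (b + i))" if k: "k \<le> r" "b + k \<le> N" for k b
  proof -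
    have "0 < fdet k (\<lambda>i j. A (I i) (b + j))"
      by (rule fekete_rows[where N = N])
        (use k contiguous I in \<open>auto simp: strict_mono_on_def\<close>)
    then show ?thesis by (subst fdet_transpose)
  qed
  then have "0 < fdet r (\<lambda>i j. A (I j) (J i))"
    by (rule fekete_rows[where A = "\<lambda>i j. A (I j) i"]) (use J in auto)
  then show ?thesis by (subst (asm) fdet_transpose)
qed

subsection \<open>Positive semidefinite matrices\<close>

definition quad :: "nat \<Rightarrow> (nat \<Rightarrow> nat \<Rightarrow> real) \<Rightarrow> (nat \<Rightarrow> real) \<Rightarrow> real" where
  "quad n A v = (\<Sum>i<n. \<Sum>j<n. v i * v j * A i j)"

definition psd :: "nat \<Rightarrow> (nat \<Rightarrow> nat \<Rightarrow> real) \<Rightarrow> bool" where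
  "psd n A \<longleftrightarrow> (\<forall>i<n. \<forall>j<n. A i j = A j i) \<and> (\<forall>v. 0 \<le> quad n A v)"

definition pd :: "nat \<Rightarrow> (nat \<Rightarrow> nat \<Rightarrow> real) \<Rightarrow> bool" where
  "pd n A \<longleftrightarrow> (\<forall>i<n. \<forall>j<n. A i j = A j i) \<and> (\<forall>v. (\<exists>i<n. v i \<noteq> 0) \<longrightarrow> 0 < quad n A v)"

definition schur_complement :: "(nat \<Rightarrow> nat \<Rightarrow> real) \<Rightarrow> nat \<Rightarrow> nat \<Rightarrow> real" where
  "schur_complement A i j = A (Suc i) (Suc j) - A (Suc i) 0 * A 0 (Suc j) / A 0 0"

section \<open>Schur complements and criteria by minors\<close>

lemma quad_cong:
  assumes "\<And>i j. i < n \<Longrightarrow> j < n \<Longrightarrow> A i j = B i j" "\<And>i. i < n \<Longrightarrow> v i = w i"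
  shows "quad n A v = quad n B w"
  unfolding quad_def using assms by (intro sum.cong) auto

lemma psd_cong:
  assumes "\<And>i j. i < n \<Longrightarrow> j < n \<Longrightarrow> A i j = B i j"
  shows "psd n A = psd n B"
  unfolding psd_def using quad_cong[of n A B] assms by simp

lemma quad_Suc:
  assumes "\<And>i. i < n \<Longrightarrow> A (Suc i) 0 = A 0 (Suc i)"
  shows "quad (Suc n) A v = (v 0)\<^sup>2 * A 0 0 + 2 * v 0 * (\<Sum>j<n. v (Suc j) * A 0 (Suc j))
    + quad n (\<lambda>i j. A (Suc i) (Suc j)) (\<lambda>i. v (Suc i))"
proof -
  have "(\<Sum>i<n. v (Suc i) * v 0 * A (Suc i) 0) = v 0 * (\<Sum>j<n. v (Suc j) * A 0 (Suc j))"
    unfolding sum_distrib_left using assms by (intro sum.cong) auto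
  moreover have "(\<Sum>j<n. v 0 * v (Suc j) * A 0 (Suc j)) = v 0 * (\<Sum>j<n. v (Suc j) * A 0 (Suc j))"
    unfolding sum_distrib_left by (intro sum.cong) auto
  ultimately show ?thesis
    unfolding quad_def sum.lessThan_Suc_shift
    by (simp add: sum.distrib power2_eq_square)
qed

text \<open>Completing the square in \<open>v 0\<close>.\<close>

lemma quad_schur_complement:
  assumes sym: "\<And>i. i < n \<Longrightarrow> A (Suc i) 0 = A 0 (Suc i)" and A0: "A 0 0 \<noteq> 0"
  shows "quad (Suc n) A v = A 0 0 * (v 0 + (\<Sum>j<n. v (Suc j) * A 0 (Suc j)) / A 0 0)\<^sup>2
    + quad n (schur_complement A) (\<lambda>i. v (Suc i))"
proof -
  let ?L = "\<Sum>j<n. v (Suc j) * A 0 (Suc j)"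
  have "quad n (schur_complement A) (\<lambda>i. v (Suc i))
      = (\<Sum>i<n. \<Sum>j<n. v (Suc i) * v (Suc j) * A (Suc i) (Suc j)
          - (v (Suc i) * A 0 (Suc i)) * (v (Suc j) * A 0 (Suc j)) / A 0 0)"
    unfolding quad_def schur_complement_def
    by (intro sum.cong) (auto simp: sym algebra_simps)
  also have "\<dots> = quad n (\<lambda>i j. A (Suc i) (Suc j)) (\<lambda>i. v (Suc i)) - ?L * ?L / A 0 0"
    unfolding quad_def sum_subtractf sum_product sum_divide_distrib by simp
  finally have S: "quad n (schur_complement A) (\<lambda>i. v (Suc i))
      = quad n (\<lambda>i j. A (Suc i) (Suc j)) (\<lambda>i. v (Suc i)) - ?L * ?L / A 0 0" .
  have "quad (Suc n) A v = (v 0)\<^sup>2 * A 0 0 + 2 * v 0 * ?L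
      + quad n (\<lambda>i j. A (Suc i) (Suc j)) (\<lambda>i. v (Suc i))"
    using sym by (rule quad_Suc)
  then show ?thesis
    unfolding S using A0 by (simp add: field_simps power2_eq_square)
qed

text \<open>The first coordinate is chosen so that the completed square vanishes.\<close>

lemma quad_schur_complement_extend:
  assumes sym: "\<And>i. i < n \<Longrightarrow> A (Suc i) 0 = A 0 (Suc i)" and A0: "A 0 0 \<noteq> 0"
  shows "quad n (schur_complement A) w
    = quad (Suc n) A (\<lambda>i. case i of 0 \<Rightarrow> - (\<Sum>j<n. w j * A 0 (Suc j)) / A 0 0 | Suc j \<Rightarrow> w j)"
  using A0 by (subst quad_schur_complement[OF sym]) (auto simp: divide_simps)

lemma schur_complement_sym:
  assumes "\<forall>i<Suc n. \<forall>j<Suc n. A i j = A j i"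
  shows "\<forall>i<n. \<forall>j<n. schur_complement A i j = schur_complement A j i"
  using assms by (auto simp: schur_complement_def)

lemma psd_schur_complement:
  assumes "psd (Suc n) A" "0 < A 0 0"
  shows "psd n (schur_complement A)"
  using assms schur_complement_sym[of n A]
  unfolding psd_def by (auto simp: quad_schur_complement_extend)

lemma psd_of_schur_complement:
  assumes "\<forall>i<Suc n. \<forall>j<Suc n. A i j = A j i" "0 < A 0 0" "psd n (schur_complement A)"
  shows "psd (Suc n) A"
  using assms unfolding psd_def by (auto simp: quad_schur_complement)

text \<open>Sylvester's criterion. By condensation the leading minors of the Schur complement are
  those of \<open>A\<close>, one order higher, divided by \<open>A 0 0\<close>, so induction
  applies.\<close>

lemma pd_of_leading_minors:
  assumes "\<forall>i<n. \<forall>j<n. A i j = A j i" "\<And>k. k \<le> n \<Longrightarrow> 0 < fdet k A"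
  shows "pd n A"
  using assms
proof (induction n arbitrary: A)
  case 0
  then show ?case by (simp add: pd_def)
next
  case (Suc n)
  have A0: "0 < A 0 0" using Suc.prems(2)[of "Suc 0"] by (simp add: fdet_1)
  have "pd n (schur_complement A)"
  proof (rule Suc.IH[OF schur_complement_sym[OF Suc.prems(1)]])
    fix k assume "k \<le> n"
    then have "0 < fdet (Suc k) A" by (intro Suc.prems(2)) simp
    then show "0 < fdet k (schur_complement A)"
      using A0 by (simp add: fdet_chio schur_complement_def[abs_def] zero_less_mult_iff)
  qed
  moreover have "0 < quad (Suc n) A v" if v: "\<exists>i<Suc n. v i \<noteq> 0"
    and pd: "\<And>v. \<exists>i<n. v i \<noteq> 0 \<Longrightarrow> 0 < quad n (schur_complement A) v" for v
  proof (cases "\<exists>i<n. v (Suc i) \<noteq> 0")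
    case True
    then have "0 < quad n (schur_complement A) (\<lambda>i. v (Suc i))" by (rule pd)
    then show ?thesis
      using A0 Suc.prems(1) by (subst quad_schur_complement) (auto intro!: add_nonneg_pos)
  next
    case False
    then have "v 0 \<noteq> 0" using v by (metis less_Suc_eq_0_disj)
    moreover have "quad (Suc n) A v = (v 0)\<^sup>2 * A 0 0"
      using False Suc.prems(1) by (subst quad_Suc) (auto simp: quad_def)
    ultimately show ?thesis using A0 by simp
  qed
  ultimately show ?case using Suc.prems(1) unfolding pd_def by blast
qed

lemma fdet_pos_of_pd: "pd n A \<Longrightarrow> 0 < fdet n A"
proof (induction n arbitrary: A)
  case (Suc n)
  then have sym: "\<forall>i<Suc n. \<forall>j<Suc n. A i j = A j i"
    and pos: "\<And>v. \<exists>i<Suc n. v i \<noteq> 0 \<Longrightarrow> 0 < quad (Suc n) A v"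
    unfolding pd_def by auto
  have "quad (Suc n) A (\<lambda>i. if i = 0 then 1 else 0) = A 0 0"
    using sym by (subst quad_Suc) (auto simp: quad_def)
  then have A0: "0 < A 0 0" using pos[of "\<lambda>i. if i = 0 then 1 else 0"] by force
  have "0 < quad n (schur_complement A) w" if w: "\<exists>i<n. w i \<noteq> 0" for w
  proof -
    obtain i where "i < n" "w i \<noteq> 0" using w by blast
    then show ?thesis
      using A0 sym by (subst quad_schur_complement_extend) (auto intro!: pos exI[of _ "Suc i"])
  qed
  then have "0 < fdet n (schur_complement A)"
    using Suc.IH schur_complement_sym[OF sym] unfolding pd_def by blast
  then show ?case
    using A0 by (simp add: fdet_chio schur_complement_def[abs_def])
qed simp

lemma pd_add_psd:
  assumes "psd n A" "pd n B" "0 < \<epsilon>"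
  shows "pd n (\<lambda>i j. A i j + \<epsilon> * B i j)"
proof -
  have "quad n (\<lambda>i j. A i j + \<epsilon> * B i j) v = quad n A v + \<epsilon> * quad n B v" for v
    unfolding quad_def by (simp add: sum_distrib_left sum.distrib algebra_simps)
  then show ?thesis
    using assms unfolding psd_def pd_def by (auto intro!: add_nonneg_pos)
qed

lemma psd_of_zero_row:
  assumes "\<forall>i<Suc n. \<forall>j<Suc n. A i j = A j i" "\<And>i. i \<le> n \<Longrightarrow> A 0 i = 0"
  shows "psd (Suc n) A \<longleftrightarrow> psd n (\<lambda>i j. A (Suc i) (Suc j))"
proof -
  have "quad (Suc n) A v = quad n (\<lambda>i j. A (Suc i) (Suc j)) (\<lambda>i. v (Suc i))" for v
    using assms by (subst quad_Suc) auto
  moreover have "\<exists>v. w = (\<lambda>i. v (Suc i))" for w :: "nat \<Rightarrow> real"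
    by (rule exI[of _ "\<lambda>i. w (i - 1)"]) simp
  ultimately show ?thesis
    using assms(1) unfolding psd_def by (metis Suc_mono)
qed

text \<open>The quadratic form at \<open>t\<close> times the unit vector at \<open>a\<close> plus
  the unit vector at \<open>b\<close>. The case \<open>a = b\<close> is included and yields the
  diagonal entry at \<open>t = 0\<close>.\<close>

lemma psd_two_by_two:
  assumes "psd n A" "a < n" "b < n"
  shows "0 \<le> t\<^sup>2 * A a a + 2 * t * A a b + A b b"
proof -
  have inner: "(\<Sum>j<n. ((if j = a then t else 0) + (if j = b then 1 else 0)) * f j) = t * f a + f b" for f
    using assms(2,3) by (simp add: distrib_right sum.distrib if_distrib[where f = "\<lambda>x. x * _"] cong: if_cong)
  have "0 \<le> quad n A (\<lambda>i. (if i = a then t else 0) + (if i = b then 1 else 0))"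
    using assms(1) unfolding psd_def by blast
  also have "quad n A (\<lambda>i. (if i = a then t else 0) + (if i = b then 1 else 0))
      = (\<Sum>i<n. ((if i = a then t else 0) + (if i = b then 1 else 0)) *
          (\<Sum>j<n. ((if j = a then t else 0) + (if j = b then 1 else 0)) * A i j))"
    unfolding quad_def sum_distrib_left by (simp only: mult.assoc)
  also have "\<dots> = t\<^sup>2 * A a a + 2 * t * A a b + A b b"
    unfolding inner using assms unfolding psd_def by (simp add: power2_eq_square algebra_simps)
  finally show ?thesis .
qed

lemma psd_diag_nonneg: "psd n A \<Longrightarrow> i < n \<Longrightarrow> 0 \<le> A i i"
  using psd_two_by_two[of n A i i 0] by simp

lemma psd_zero_diag_row:
  assumes "psd n A" "a < n" "b < n" "A a a = 0"
  shows "A a b = 0"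
proof (rule ccontr)
  assume nz: "A a b \<noteq> 0"
  \<comment> \<open>With \<open>A a a = 0\<close> the form is affine in \<open>t\<close>; this
    choice of \<open>t\<close> gives it the value -1.\<close>
  have "0 \<le> 2 * (- (A b b + 1) / (2 * A a b)) * A a b + A b b"
    using psd_two_by_two[OF assms(1-3)] assms(4) by (metis add_0 mult_zero_right)
  then show False using nz by (simp add: field_simps)
qed

text \<open>Leading minors do not suffice in the semidefinite case because a pivot may vanish; then
  the principal minors of order two force row 0 to vanish. With a positive pivot the Schur
  complement inherits the hypothesis.\<close>

theorem psd_of_principal_minors:
  assumes "\<forall>i<n. \<forall>j<n. A i j = A j i"
    and "\<And>k I. strict_mono_on {..<k::nat} I \<Longrightarrow> (\<And>i. i < k \<Longrightarrow> I i < n) \<Longrightarrow> 0 \<le> fdet k (\<lambda>i j. A (I i) (I j))"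
  shows "psd n A"
  using assms
proof (induction n arbitrary: A)
  case 0
  then show ?case by (simp add: psd_def quad_def)
next
  case (Suc n)
  show ?case
  proof (cases "A 0 0 = 0")
    case True
    have "A 0 i = 0" if i: "i \<le> n" for i
    proof (cases "i = 0")
      case False
      define J where "J = (\<lambda>k::nat. if k = 0 then 0 else i)"
      have "0 \<le> fdet 2 (\<lambda>a b. A (J a) (J b))"
        by (rule Suc.prems(2)) (use False i in \<open>auto simp: J_def strict_mono_on_def\<close>)
      also have "fdet 2 (\<lambda>a b. A (J a) (J b)) = - (A 0 i * A i 0)"
        using True by (simp add: fdet_2 J_def)
      also have "\<dots> = - (A 0 i)\<^sup>2"
        using Suc.prems(1) i by (simp add: power2_eq_square)
      finally show ?thesis by simp
    qed (use True in simp)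
    moreover have "psd n (\<lambda>i j. A (Suc i) (Suc j))"
    proof (rule Suc.IH)
      fix k and I :: "nat \<Rightarrow> nat"
      assume "strict_mono_on {..<k::nat} I" "\<And>i. i < k \<Longrightarrow> I i < n"
      then show "0 \<le> fdet k (\<lambda>i j. A (Suc (I i)) (Suc (I j)))"
        using Suc.prems(2)[of k "\<lambda>i. Suc (I i)"] by (simp add: strict_mono_on_def)
    qed (use Suc.prems(1) in auto)
    ultimately show ?thesis using psd_of_zero_row[OF Suc.prems(1)] by blast
  next
    case False
    moreover have "0 \<le> A 0 0"
    proof -
      have "strict_mono_on {..<Suc 0} (\<lambda>_. 0::nat)" by (rule strict_mono_onI) auto
      from Suc.prems(2)[OF this] show ?thesis by (simp add: fdet_1)
    qed
    ultimately have A0: "0 < A 0 0" by simp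
    have "psd n (schur_complement A)"
    proof (rule Suc.IH[OF schur_complement_sym[OF Suc.prems(1)]])
      fix k and I :: "nat \<Rightarrow> nat"
      assume I: "strict_mono_on {..<k::nat} I" "\<And>i. i < k \<Longrightarrow> I i < n"
      \<comment> \<open>Index 0 is put in front: condensation then identifies a principal minor of
        the Schur complement with one of \<open>A\<close>, up to the factor
        \<open>A 0 0\<close>.\<close>
      let ?I = "\<lambda>i. case i of 0 \<Rightarrow> 0 | Suc j \<Rightarrow> Suc (I j)"
      have "0 \<le> fdet (Suc k) (\<lambda>i j. A (?I i) (?I j))"
      proof (rule Suc.prems(2))
        show "strict_mono_on {..<Suc k} ?I"
          using I(1) by (auto simp: strict_mono_on_def split: nat.split)
        show "?I i < Suc n" if "i < Suc k" for i
          using I(2) that by (auto split: nat.split)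
      qed
      then show "0 \<le> fdet k (\<lambda>i j. schur_complement A (I i) (I j))"
        using A0 by (simp add: fdet_chio schur_complement_def zero_le_mult_iff)
    qed
    then show ?thesis using psd_of_schur_complement[OF Suc.prems(1) A0] by blast
  qed
qed

section \<open>Gram matrices and entrywise products\<close>

lemma psd_gram:
  assumes "psd n A"
  shows "\<exists>w. \<forall>i<n. \<forall>j<n. A i j = (\<Sum>k<n. w k i * w k j)"
  using assms
proof (induction n arbitrary: A)
  case (Suc n)
  have sym: "\<forall>i<Suc n. \<forall>j<Suc n. A i j = A j i" using Suc.prems unfolding psd_def by blast
  \<comment> \<open>One step of the Cholesky factorization: \<open>w0\<close> is row 0 over the
    square root of the pivot, or zero if the pivot is, and \<open>w\<close> factors the remaining
    block.\<close>
  have "\<exists>w0 w. A 0 0 = w0 0 * w0 0 \<and> (\<forall>i<n. A 0 (Suc i) = w0 0 * w0 (Suc i)) \<and>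
     (\<forall>i<n. \<forall>j<n. A (Suc i) (Suc j) = w0 (Suc i) * w0 (Suc j) + (\<Sum>k<n. w k i * w k j))"
  proof (cases "A 0 0 = 0")
    case True
    then have z: "\<And>i. i \<le> n \<Longrightarrow> A 0 i = 0"
      using psd_zero_diag_row[OF Suc.prems, of 0] by simp
    then have "psd n (\<lambda>i j. A (Suc i) (Suc j))"
      using psd_of_zero_row[OF sym] Suc.prems by blast
    from Suc.IH[OF this] obtain w where "\<forall>i<n. \<forall>j<n. A (Suc i) (Suc j) = (\<Sum>k<n. w k i * w k j)"
      by blast
    then show ?thesis using z by (intro exI[of _ "\<lambda>_. 0"] exI[of _ w]) auto
  next
    case False
    then have A0: "0 < A 0 0" using psd_diag_nonneg[OF Suc.prems, of 0] by simp
    from Suc.IH[OF psd_schur_complement[OF Suc.prems A0]]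
    obtain w where w: "\<forall>i<n. \<forall>j<n. schur_complement A i j = (\<Sum>k<n. w k i * w k j)"
      by blast
    have "A (Suc i) (Suc j) = A 0 (Suc i) / sqrt (A 0 0) * (A 0 (Suc j) / sqrt (A 0 0)) + (\<Sum>k<n. w k i * w k j)"
      if "i < n" "j < n" for i j
      using w[rule_format, OF that] A0 sym that by (simp add: schur_complement_def algebra_simps)
    then show ?thesis
      using A0 by (intro exI[of _ "\<lambda>i. A 0 i / sqrt (A 0 0)"] exI[of _ w]) (simp add: divide_simps)
  qed
  then obtain w0 w where w: "A 0 0 = w0 0 * w0 0" "\<And>i. i < n \<Longrightarrow> A 0 (Suc i) = w0 0 * w0 (Suc i)"
     "\<And>i j. i < n \<Longrightarrow> j < n \<Longrightarrow> A (Suc i) (Suc j) = w0 (Suc i) * w0 (Suc j) + (\<Sum>k<n. w k i * w k j)"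
    by blast
  let ?w = "\<lambda>k i. case k of 0 \<Rightarrow> w0 i | Suc k \<Rightarrow> (case i of 0 \<Rightarrow> 0 | Suc i \<Rightarrow> w k i)"
  have "A i j = (\<Sum>k<Suc n. ?w k i * ?w k j)" if "i < Suc n" "j < Suc n" for i j
    using that w sym unfolding sum.lessThan_Suc_shift
    by (cases i; cases j) (auto simp: mult.commute)
  then show ?case by (intro exI[of _ ?w]) blast
qed simp

text \<open>Writing \<open>B\<close> as a Gram matrix turns the form of the entrywise product at
  \<open>v\<close> into a sum of forms of \<open>A\<close> at rescalings of
  \<open>v\<close>.\<close>

theorem schur_product:
  assumes A: "psd n A" and B: "psd n B"
  shows "psd n (\<lambda>i j. A i j * B i j)"
proof -
  obtain w where w: "\<And>i j. i < n \<Longrightarrow> j < n \<Longrightarrow> B i j = (\<Sum>k<n. w k i * w k j)"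
    using psd_gram[OF B] by blast
  have "quad n (\<lambda>i j. A i j * B i j) v = (\<Sum>k<n. quad n A (\<lambda>i. v i * w k i))" for v
  proof -
    have "quad n (\<lambda>i j. A i j * B i j) v = (\<Sum>i<n. \<Sum>j<n. \<Sum>k<n. (v i * w k i) * (v j * w k j) * A i j)"
      unfolding quad_def by (intro sum.cong) (auto simp: w sum_distrib_left mult_ac)
    also have "\<dots> = (\<Sum>i<n. \<Sum>k<n. \<Sum>j<n. (v i * w k i) * (v j * w k j) * A i j)"
      by (intro sum.cong refl sum.swap)
    also have "\<dots> = (\<Sum>k<n. quad n A (\<lambda>i. v i * w k i))"
      unfolding quad_def by (rule sum.swap)
    finally show ?thesis .
  qed
  moreover have "0 \<le> (\<Sum>k<n. quad n A (\<lambda>i. v i * w k i))" for v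
    using A unfolding psd_def by (intro sum_nonneg) auto
  ultimately show ?thesis using A B unfolding psd_def by auto
qed

lemma psd_rank_one: "psd n (\<lambda>i j. z i * z j)"
proof -
  have "quad n (\<lambda>i j. z i * z j) v = (\<Sum>i<n. v i * z i)\<^sup>2" for v
    unfolding quad_def power2_eq_square sum_product by (intro sum.cong) auto
  then show ?thesis unfolding psd_def by (auto simp: mult.commute)
qed

lemma psd_add:
  assumes "psd n A" "psd n B"
  shows "psd n (\<lambda>i j. A i j + B i j)"
proof -
  have "quad n (\<lambda>i j. A i j + B i j) v = quad n A v + quad n B v" for v
    unfolding quad_def by (simp add: sum.distrib algebra_simps)
  then show ?thesis using assms unfolding psd_def by auto
qed

lemma psd_mult_const: "psd n A \<Longrightarrow> 0 \<le> c \<Longrightarrow> psd n (\<lambda>i j. c * A i j)"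
  using schur_product[OF _ psd_rank_one[of n "\<lambda>_. sqrt c"], of A] by (simp add: mult.commute)

lemma psd_power: "psd n A \<Longrightarrow> psd n (\<lambda>i j. A i j ^ m)"
proof (induction m)
  case 0
  then show ?case using psd_rank_one[of n "\<lambda>_. 1"] by simp
next
  case (Suc m)
  then show ?case using schur_product[OF Suc.prems Suc.IH] by simp
qed

text \<open>Along a segment from a rank one matrix to \<open>A\<close> the quadratic form of the
  entrywise power does not decrease: its derivative is a form of the entrywise product of a power
  with exponent \<open>\<alpha> - 1\<close> and the Schur complement. Size and exponent both drop by
  one, so the bound on the exponent is inherited.\<close>

theorem fitzgerald_horn:
  assumes "psd n A" "\<And>i j. i < n \<Longrightarrow> j < n \<Longrightarrow> 0 < A i j" "real n - 2 \<le> \<alpha>"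
  shows "psd n (\<lambda>i j. A i j powr \<alpha>)"
  using assms
proof (induction n arbitrary: A \<alpha>)
  case 0
  then show ?case by (simp add: psd_def quad_def)
next
  case (Suc n)
  show ?case
  proof (cases "n = 0")
    \<comment> \<open>The exponent may be negative here, but the power of a single entry is still
      nonnegative.\<close>
    case True
    then show ?thesis by (simp add: psd_def quad_def)
  next
    case False
    then have \<alpha>: "0 \<le> \<alpha>" using Suc.prems(3) by (cases n) auto
    have sym: "\<forall>i<Suc n. \<forall>j<Suc n. A i j = A j i" using Suc.prems(1) unfolding psd_def by blast
    have A0: "0 < A 0 0" using Suc.prems(2) by simp
    define Z where "Z = (\<lambda>i j. A 0 i * A 0 j / A 0 0)"
    \<comment> \<open>\<open>Z\<close> has rank one and agrees with \<open>A\<close> in row and column 0, so the derivative of the quadratic form of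
      \<open>B t powr \<alpha>\<close> only involves a matrix of size \<open>n\<close> and the exponent \<open>\<alpha> - 1\<close>.\<close>
    define B where "B = (\<lambda>t i j. Z i j + t * (A i j - Z i j))"
    have Z: "0 < Z i j" if "i < Suc n" "j < Suc n" for i j
      unfolding Z_def using Suc.prems(2) that by simp
    have Bpos: "0 < B t i j" if "i < Suc n" "j < Suc n" "0 \<le> t" "t \<le> 1" for t i j
    proof -
      have "B t i j = (1 - t) * Z i j + t * A i j" by (simp add: B_def algebra_simps)
      also have "0 < \<dots>"
        using Z[OF that(1,2)] Suc.prems(2)[OF that(1,2)] that(3,4)
        by (cases "t = 0") (auto intro!: add_nonneg_pos)
      finally show ?thesis .
    qed
    have AZ: "A i j - Z i j = (if i = 0 \<or> j = 0 then 0 else schur_complement A (i - 1) (j - 1))"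
      if "i < Suc n" "j < Suc n" for i j
      using that sym A0 by (cases i; cases j) (auto simp: Z_def schur_complement_def)
    have S: "psd n (schur_complement A)"
      using psd_schur_complement[OF Suc.prems(1) A0] .
    have psdAZ: "psd (Suc n) (\<lambda>i j. A i j - Z i j)"
    proof -
      have "psd (Suc n) (\<lambda>i j. if i = 0 \<or> j = 0 then 0 else schur_complement A (i - 1) (j - 1))"
        using S schur_complement_sym[OF sym] by (subst psd_of_zero_row) auto
      then show ?thesis by (subst psd_cong[OF AZ]) auto
    qed
    have psdZ: "psd (Suc n) Z"
      using psd_rank_one[of "Suc n" "\<lambda>i. A 0 i / sqrt (A 0 0)"] A0 by (simp add: Z_def[abs_def])
    have "0 \<le> quad (Suc n) (\<lambda>i j. A i j powr \<alpha>) v" for v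
    proof -
      define g where "g = (\<lambda>t. quad (Suc n) (\<lambda>i j. B t i j powr \<alpha>) v)"
      define g' where "g' = (\<lambda>t. quad (Suc n) (\<lambda>i j. \<alpha> * B t i j powr (\<alpha> - 1) * (A i j - Z i j)) v)"
      have deriv: "(g has_real_derivative g' t) (at t)" if t: "0 \<le> t" "t \<le> 1" for t
      proof -
        have "((\<lambda>t. v i * v j * B t i j powr \<alpha>) has_real_derivative
            v i * v j * (\<alpha> * B t i j powr (\<alpha> - 1) * (A i j - Z i j))) (at t)"
          if "i < Suc n" "j < Suc n" for i j
        proof -
          have "((\<lambda>t. B t i j) has_real_derivative (A i j - Z i j)) (at t)"
            unfolding B_def by (auto intro!: derivative_eq_intros)
          from DERIV_fun_powr[OF this Bpos[OF that t], of \<alpha>] show ?thesis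
            by (intro DERIV_cmult) simp
        qed
        then show ?thesis unfolding g_def g'_def quad_def by (intro DERIV_sum) auto
      qed
      have nonneg: "0 \<le> g' t" if t: "0 \<le> t" "t \<le> 1" for t
      proof -
        have "psd (Suc n) (B t)"
          unfolding B_def by (intro psd_add psd_mult_const psdZ psdAZ t)
        then have "psd n (\<lambda>i j. B t (Suc i) (Suc j))"
          unfolding psd_def
        proof (intro conjI allI impI, goal_cases)
          case (2 w)
          have "0 \<le> quad (Suc n) (B t) (\<lambda>i. case i of 0 \<Rightarrow> 0 | Suc j \<Rightarrow> w j)" using 2 by blast
          then show ?case using 2 by (subst (asm) quad_Suc) auto
        qed auto
        then have "psd n (\<lambda>i j. B t (Suc i) (Suc j) powr (\<alpha> - 1))"
          by (rule Suc.IH) (use Bpos t Suc.prems(3) in auto)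
        from schur_product[OF this S] have "psd n (\<lambda>i j. \<alpha> * (B t (Suc i) (Suc j) powr (\<alpha> - 1) * schur_complement A i j))"
          using \<alpha> by (rule psd_mult_const)
        moreover have "g' t = quad n (\<lambda>i j. \<alpha> * (B t (Suc i) (Suc j) powr (\<alpha> - 1) * schur_complement A i j)) (\<lambda>i. v (Suc i))"
          unfolding g'_def by (subst quad_Suc) (auto simp: AZ intro!: quad_cong)
        ultimately show ?thesis unfolding psd_def by simp
      qed
      have "g 0 \<le> g 1"
        by (rule DERIV_nonneg_imp_nondecreasing[of 0 1 g]) (use deriv nonneg in auto)
      \<comment> \<open>At \<open>t = 0\<close> the matrix is \<open>Z\<close>, and an entrywise
        power of a positive rank one matrix has rank one again.\<close>
      moreover have "0 \<le> g 0"
      proof -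
        have "g 0 = quad (Suc n) (\<lambda>i j. (A 0 i / sqrt (A 0 0)) powr \<alpha> * (A 0 j / sqrt (A 0 0)) powr \<alpha>) v"
          unfolding g_def
        proof (rule quad_cong)
          fix i j assume ij: "i < Suc n" "j < Suc n"
          have "B 0 i j = (A 0 i / sqrt (A 0 0)) * (A 0 j / sqrt (A 0 0))"
            using A0 by (simp add: B_def Z_def)
          then show "B 0 i j powr \<alpha> = (A 0 i / sqrt (A 0 0)) powr \<alpha> * (A 0 j / sqrt (A 0 0)) powr \<alpha>"
            using A0 Suc.prems(2)[of 0 i] Suc.prems(2)[of 0 j] ij by (simp only:) (rule powr_mult)
        qed simp
        then show ?thesis using psd_rank_one unfolding psd_def by metis
      qed
      moreover have "g 1 = quad (Suc n) (\<lambda>i j. A i j powr \<alpha>) v"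
        by (simp add: g_def B_def)
      ultimately show ?thesis by simp
    qed
    then show ?thesis using sym unfolding psd_def by simp
  qed
qed

subsection \<open>Hankel kernels\<close>

lemma inc_iff: "x \<in> inc X r \<longleftrightarrow> (\<forall>i<r. x i \<in> X) \<and> strict_mono_on {..<r} x"
  unfolding inc_def strict_mono_on_def by auto

lemma inc_comp:
  assumes "x \<in> inc X r" "strict_mono_on {..<k} I" "\<And>i. i < k \<Longrightarrow> I i < r"
  shows "(\<lambda>i. x (I i)) \<in> inc X k"
  using assms unfolding inc_iff strict_mono_on_def by auto

lemma strict_mono_on_bounded_le:
  fixes I :: "nat \<Rightarrow> nat"
  assumes "strict_mono_on {..<k} I" "\<And>i. i < k \<Longrightarrow> I i < r"
  shows "k \<le> r"
  using card_inj_on_le[OF strict_mono_on_imp_inj_on[OF assms(1)], of "{..<r}"] assms(2) by auto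

lemma TN_kernel_iff:
  "TN_kernel p X Y K \<longleftrightarrow> (\<forall>r. 1 \<le> r \<and> r \<le> p \<longrightarrow>
     (\<forall>x\<in>inc X r. \<forall>y\<in>inc Y r. 0 \<le> fdet r (\<lambda>i j. K (x i) (y j))))"
  unfolding TN_kernel_def kmat_def fdet_def ..

lemma TN_kernel_mono: "TN_kernel p X Y K \<Longrightarrow> q \<le> p \<Longrightarrow> TN_kernel q X Y K"
  unfolding TN_kernel_def by auto

lemma hankelD:
  "hankel X K \<Longrightarrow> x \<in> X \<Longrightarrow> y \<in> X \<Longrightarrow> z \<in> X \<Longrightarrow> w \<in> X \<Longrightarrow> x + y = z + w \<Longrightarrow> K x y = K z w"
  unfolding hankel_def by metis

lemma hankel_sym: "hankel X K \<Longrightarrow> x \<in> X \<Longrightarrow> y \<in> X \<Longrightarrow> K x y = K y x"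
  by (rule hankelD) (auto simp: add.commute)

lemma pos_intervalD: "pos_interval X \<Longrightarrow> a \<in> X \<Longrightarrow> c \<in> X \<Longrightarrow> a \<le> b \<Longrightarrow> b \<le> c \<Longrightarrow> b \<in> X"
  unfolding pos_interval_def by blast

text \<open>Principal minors of the matrix are minors of the kernel at subtuples of
  \<open>x\<close>, of order at most \<open>p\<close>.\<close>

lemma psd_of_TN_kernel:
  assumes "TN_kernel p X X K" "hankel X K" "r \<le> p" "x \<in> inc X r"
  shows "psd r (\<lambda>i j. K (x i) (x j))"
proof (rule psd_of_principal_minors)
  show "\<forall>i<r. \<forall>j<r. K (x i) (x j) = K (x j) (x i)"
    using hankel_sym[OF assms(2)] assms(4) by (auto simp: inc_iff)
next
  fix k and I :: "nat \<Rightarrow> nat"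
  assume I: "strict_mono_on {..<k} I" "\<And>i. i < k \<Longrightarrow> I i < r"
  then have "(\<lambda>i. x (I i)) \<in> inc X k" by (rule inc_comp[OF assms(4)])
  moreover have "k \<le> p" using strict_mono_on_bounded_le[OF I] assms(3) by simp
  ultimately show "0 \<le> fdet k (\<lambda>i j. K (x (I i)) (x (I j)))"
    using assms(1) unfolding TN_kernel_iff by (cases k) auto
qed

lemma TN_kernel_of_psd:
  assumes X: "pos_interval X" and cont: "kernel_continuous X K" and hk: "hankel X K"
    and psd: "\<And>r x. r \<le> p \<Longrightarrow> x \<in> inc X r \<Longrightarrow> psd r (\<lambda>i j. K (x i) (x j))"
  shows "TN_kernel p X X K"
  unfolding TN_kernel_iff
proof (intro allI impI ballI, elim conjE)
  fix r x y assume r: "1 \<le> r" "r \<le> p" and x: "x \<in> inc X r" and y: "y \<in> inc X r"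
  \<comment> \<open>The perturbation is the kernel of \<open>jain_determinant\<close> with
    \<open>c = s = 1\<close> and exponent \<open>p\<close>, whose determinants of order at most
    \<open>p\<close> are positive since \<open>p > p - 2\<close>. It depends on \<open>x + y\<close>
    only, so adding it keeps the Hankel structure.\<close>
  define G :: "real \<Rightarrow> real \<Rightarrow> real" where "G = (\<lambda>x y. (1 + 1 * exp (1 * (x + y))) powr real p)"
  have pdG: "pd k (\<lambda>i j. G (z i) (z j))" if "k \<le> p" "strict_mono_on {..<k} z" for k z
  proof (rule pd_of_leading_minors)
    show "\<forall>i<k. \<forall>j<k. G (z i) (z j) = G (z j) (z i)" by (simp add: G_def add.commute)
    fix l assume l: "l \<le> k"
    have "0 < 1 * fdet l (\<lambda>i j. G (z i) (z j))"
      unfolding G_def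
    proof (rule jain_determinant)
      show "strict_mono_on {..<l} z" "strict_mono_on {..<l} z"
        using that(2) l by (auto simp: strict_mono_on_def)
      show "0 < 1 * jain_sign l (real p)"
        using jain_sign_pos[of l "real p"] l that(1) by simp
    qed auto
    then show "0 < fdet l (\<lambda>i j. G (z i) (z j))" by simp
  qed
  obtain a b where ab: "a \<in> X" "b \<in> X" "a < b" using X unfolding pos_interval_def by blast
  \<comment> \<open>The points \<open>a\<close> and \<open>b\<close> are included so that the grid
    has positive length even if \<open>x\<close> and \<open>y\<close> consist of a single common
    point.\<close>
  define S where "S = {a, b} \<union> x ` {..<r} \<union> y ` {..<r}"
  have S: "finite S" "S \<noteq> {}" "S \<subseteq> X"
    unfolding S_def using ab x y by (auto simp: inc_iff)
  define m where "m = Min S"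
  define M where "M = Max S"
  define D where "D = M - m"
  have mM: "m \<in> X" "M \<in> X" using S Min_in[of S] Max_in[of S] unfolding m_def M_def by blast+
  have bounds: "m \<le> t \<and> t \<le> M" if "t \<in> S" for t
    using S that unfolding m_def M_def by simp
  have D: "0 < D" using bounds[of a] bounds[of b] ab(3) unfolding D_def S_def by auto
  define h where "h = (\<lambda>N::nat. D / real N)"
  \<comment> \<open>For \<open>t\<close> in \<open>S\<close>, the index of the last point
    \<open>m + k * h N\<close> of the grid that does not exceed \<open>t\<close>.\<close>
  define ix where "ix = (\<lambda>N t. nat \<lfloor>(t - m) / h N\<rfloor>)"
  define g where "g = (\<lambda>N t. m + real (ix N t) * h N)"
  have h: "h \<longlonglongrightarrow> 0" unfolding h_def by (rule lim_const_over_n)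
  have hpos: "0 < h N" if "0 < N" for N using that D by (simp add: h_def)
  have inX: "m + q * h N \<in> X" if "0 \<le> q" "q \<le> real N" "0 < N" for q N
  proof (rule pos_intervalD[OF X mM])
    show "m \<le> m + q * h N" using that hpos[of N] by simp
    have "q * h N \<le> real N * h N" using that hpos[of N] by (intro mult_right_mono) auto
    then show "m + q * h N \<le> M" using that by (simp add: h_def D_def)
  qed
  have ix_le: "ix N t \<le> N" if "t \<in> S" "0 < N" for N t
  proof -
    have "(t - m) / h N \<le> real N"
      using bounds[OF that(1)] that(2) hpos[OF that(2)] by (simp add: divide_le_eq) (simp add: h_def D_def)
    then show ?thesis unfolding ix_def by linarith
  qed
  have floor: "real (ix N t) = of_int \<lfloor>(t - m) / h N\<rfloor>" if "t \<in> S" "0 < N" for N t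
    unfolding ix_def using bounds[OF that(1)] hpos[OF that(2)] by simp
  have g_close: "t - h N \<le> g N t \<and> g N t \<le> t" if "t \<in> S" "0 < N" for N t
  proof -
    have "(t - m) / h N - 1 \<le> real (ix N t)" "real (ix N t) \<le> (t - m) / h N"
      unfolding floor[OF that] by linarith+
    then show ?thesis
      using hpos[OF that(2)] by (simp add: g_def field_simps)
  qed
  have g_lim: "(\<lambda>N. g N t) \<longlonglongrightarrow> t" if "t \<in> S" for t
  proof (rule tendsto_sandwich)
    show "\<forall>\<^sub>F N in sequentially. t - h N \<le> g N t" "\<forall>\<^sub>F N in sequentially. g N t \<le> t"
      using g_close[OF that] by (auto intro: eventually_mono[OF eventually_gt_at_top[of 0]])
    show "(\<lambda>N. t - h N) \<longlonglongrightarrow> t" using tendsto_diff[OF tendsto_const h] by simp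
  qed simp
  have g_in: "g N t \<in> X" if "t \<in> S" "0 < N" for N t
    unfolding g_def using ix_le[OF that] that(2) by (intro inX) auto
  \<comment> \<open>Once the mesh is smaller than every gap of \<open>u\<close>, rounding down keeps
    the points distinct and in order.\<close>
  have ev_mono: "\<forall>\<^sub>F N in sequentially. strict_mono_on {..<r} (\<lambda>i. ix N (u i))"
    if u: "u \<in> inc X r" "u ` {..<r} \<subseteq> S" for u
  proof -
    have "\<forall>\<^sub>F N in sequentially. \<forall>i\<in>{..<r}. \<forall>j\<in>{..<r}. i < j \<longrightarrow> h N < u j - u i"
    proof (intro eventually_ball_finite ballI finite_lessThan)
      fix i j assume "i \<in> {..<r}" "j \<in> {..<r}"
      then have "i < j \<Longrightarrow> 0 < u j - u i" using u(1) by (simp add: inc_iff strict_mono_on_def)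
      then show "\<forall>\<^sub>F N in sequentially. i < j \<longrightarrow> h N < u j - u i"
        using order_tendstoD(2)[OF h, of "u j - u i"] by (cases "i < j") auto
    qed
    then show ?thesis
      using eventually_gt_at_top[of 0]
    proof eventually_elim
      case (elim N)
      show ?case
      proof (rule strict_mono_onI)
        fix i j assume ij: "i \<in> {..<r}" "j \<in> {..<r}" "i < j"
        then have "h N < u j - u i" using elim by blast
        then have "(u i - m) / h N + 1 < (u j - m) / h N"
          using hpos[of N] elim divide_strict_right_mono[of "u i - m + h N" "u j - m" "h N"]
          by (simp add: add_divide_distrib)
        then have "real (ix N (u i)) < real (ix N (u j))"
          using floor[of "u i" N] floor[of "u j" N] u(2) ij elim by (simp add: image_subset_iff) linarith
        then show "ix N (u i) < ix N (u j)" by simp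
      qed
    qed
  qed
  \<comment> \<open>The perturbation tends to zero along with the mesh \<open>h N\<close>, so a single limit suffices.\<close>
  define KG where "KG = (\<lambda>N u v. K u v + 1 / real N * G u v)"
  have xS: "x ` {..<r} \<subseteq> S" and yS: "y ` {..<r} \<subseteq> S" unfolding S_def by auto
  have "\<forall>\<^sub>F N in sequentially. 0 \<le> fdet r (\<lambda>i j. KG N (g N (x i)) (g N (y j)))"
    using ev_mono[OF x xS] ev_mono[OF y yS] eventually_gt_at_top[of 0]
  proof eventually_elim
    case (elim N)
    have "0 < fdet r (\<lambda>i j. KG N (m + real (ix N (x i)) * h N) (m + real (ix N (y j)) * h N))"
    proof (rule fekete[where N = "Suc N" and A = "\<lambda>k l. KG N (m + real k * h N) (m + real l * h N)"])
      fix k a b assume k: "k \<le> r" "a + k \<le> Suc N" "b + k \<le> Suc N"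
      \<comment> \<open>Row and column offsets are replaced by their average. The points
        \<open>z i\<close> may fall between grid points, but \<open>z i + z j\<close> is the sum of
        the original row and column points, so by the Hankel property the block equals a symmetric
        matrix on one tuple.\<close>
      define z where "z = (\<lambda>i. m + ((real a + real b) / 2 + real i) * h N)"
      have zm: "strict_mono_on {..<k} z"
        using hpos[OF elim(3)] by (auto simp: strict_mono_on_def z_def)
      have "z i \<in> X" if "i < k" for i
        unfolding z_def
      proof (rule inX)
        have "real (a + i) \<le> real N" "real (b + i) \<le> real N"
          using k that by (auto simp del: of_nat_add)
        then show "(real a + real b) / 2 + real i \<le> real N" by (simp add: field_simps)
      qed (use elim(3) in auto)
      then have z: "z \<in> inc X k" using zm by (simp add: inc_iff)
      have "fdet k (\<lambda>i j. KG N (m + real (a + i) * h N) (m + real (b + j) * h N))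
          = fdet k (\<lambda>i j. KG N (z i) (z j))"
      proof (rule fdet_cong)
        fix i j assume ij: "i < k" "j < k"
        have eq: "(m + real (a + i) * h N) + (m + real (b + j) * h N) = z i + z j"
          by (simp add: z_def field_simps)
        have "K (m + real (a + i) * h N) (m + real (b + j) * h N) = K (z i) (z j)"
        proof (rule hankelD[OF hk _ _ _ _ eq])
          show "z i \<in> X" "z j \<in> X" using z ij by (auto simp: inc_iff)
          show "m + real (a + i) * h N \<in> X" "m + real (b + j) * h N \<in> X"
            by (rule inX; use k ij elim(3) in simp)+
        qed
        then show "KG N (m + real (a + i) * h N) (m + real (b + j) * h N) = KG N (z i) (z j)"
          by (simp only: KG_def G_def eq)
      qed
      also have "0 < \<dots>"
        unfolding KG_def
        by (rule fdet_pos_of_pd, rule pd_add_psd)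
          (use psd[OF _ z] pdG[OF _ zm] k r elim(3) in auto)
      finally show "0 < fdet k (\<lambda>i j. KG N (m + real (a + i) * h N) (m + real (b + j) * h N))" .
    next
      show "ix N (x i) < Suc N" if "i < r" for i
        using ix_le[of "x i" N] xS that elim(3) by (auto simp: less_Suc_eq_le)
      show "ix N (y i) < Suc N" if "i < r" for i
        using ix_le[of "y i" N] yS that elim(3) by (auto simp: less_Suc_eq_le)
    qed (use elim in auto)
    then show ?case by (simp add: g_def)
  qed
  moreover have "(\<lambda>N. fdet r (\<lambda>i j. KG N (g N (x i)) (g N (y j)))) \<longlonglongrightarrow> fdet r (\<lambda>i j. K (x i) (y j))"
  proof (rule tendsto_fdet)
    fix i j assume ij: "i < r" "j < r"
    then have S': "x i \<in> S" "y j \<in> S" using xS yS by auto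
    have "(\<lambda>N. case (g N (x i), g N (y j)) of (u, v) \<Rightarrow> K u v) \<longlonglongrightarrow> (case (x i, y j) of (u, v) \<Rightarrow> K u v)"
    proof (rule continuous_on_tendsto_compose[OF cont[unfolded kernel_continuous_def]])
      show "(\<lambda>N. (g N (x i), g N (y j))) \<longlonglongrightarrow> (x i, y j)"
        by (intro tendsto_Pair g_lim S')
      show "\<forall>\<^sub>F N in sequentially. (g N (x i), g N (y j)) \<in> X \<times> X"
        using g_in S' by (auto intro: eventually_mono[OF eventually_gt_at_top[of 0]])
    qed (use S' S in auto)
    moreover have "(\<lambda>N. G (g N (x i)) (g N (y j))) \<longlonglongrightarrow> G (x i) (y j)"
    proof -
      have "1 + 1 * exp (1 * (x i + y j)) \<noteq> (0::real)"
        using exp_gt_zero[of "x i + y j"] by (simp add: add_pos_pos less_imp_neq[symmetric])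
      then show ?thesis
        unfolding G_def by (intro tendsto_intros g_lim S') auto
    qed
    ultimately show "(\<lambda>N. KG N (g N (x i)) (g N (y j))) \<longlonglongrightarrow> K (x i) (y j)"
      unfolding KG_def using tendsto_add[OF _ tendsto_mult[OF lim_const_over_n[of 1]]] by fastforce
  qed
  ultimately show "0 \<le> fdet r (\<lambda>i j. K (x i) (y j))"
    by (intro tendsto_lowerbound) auto
qed

text \<open>Supplies the positive entries that \<open>fitzgerald_horn\<close> and the continuity of
  \<open>powr\<close> call for. Minors of order two spread a zero on the diagonal along its row, and
  the Hankel property moves any zero to the diagonal, at the midpoint.\<close>

lemma hankel_zero_or_pos:
  assumes p: "2 \<le> p" and X: "pos_interval X" and cont: "kernel_continuous X H"
    and TN: "TN_kernel p X X H" and hk: "hankel X H"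
  shows "(\<forall>x\<in>X. \<forall>y\<in>X. H x y = 0) \<or> (\<forall>x\<in>X. \<forall>y\<in>X. 0 < H x y)"
proof -
  have nonneg: "0 \<le> H x y" if "x \<in> X" "y \<in> X" for x y
  proof -
    have "0 \<le> fdet (Suc 0) (\<lambda>i j. H x y)"
      using TN[unfolded TN_kernel_iff, rule_format, of "Suc 0" "\<lambda>_. x" "\<lambda>_. y"] p that
      by (auto simp: inc_def)
    then show ?thesis by (simp add: fdet_1)
  qed
  have mid: "(x + y) / 2 \<in> X" if "x \<in> X" "y \<in> X" for x y
    using pos_intervalD[OF X, of x y "(x + y) / 2"] pos_intervalD[OF X, of y x "(x + y) / 2"] that
    by (cases "x \<le> y") auto
  have Hmid: "H x y = H ((x + y) / 2) ((x + y) / 2)" if "x \<in> X" "y \<in> X" for x y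
    by (rule hankelD[OF hk that mid[OF that] mid[OF that]]) simp
  have zero: "H z w = 0" if "z \<in> X" "w \<in> X" "H z z = 0" for z w
  proof -
    \<comment> \<open>By symmetry the minor on \<open>a < b\<close> is
      \<open>H a a * H b b - (H a b)^2\<close>.\<close>
    have lt: "H a b = 0" if ab: "a \<in> X" "b \<in> X" "a < b" "H a a * H b b = 0" for a b
    proof -
      let ?x = "\<lambda>i::nat. if i = 0 then a else b"
      have "?x \<in> inc X 2" using ab by (auto simp: inc_def)
      then have "0 \<le> fdet 2 (\<lambda>i j. H (?x i) (?x j))"
        using TN[unfolded TN_kernel_iff, rule_format, of 2 ?x ?x] p by simp
      moreover have "H b a = H a b" by (rule hankel_sym[OF hk ab(2,1)])
      ultimately show ?thesis using ab(4) by (auto simp: fdet_2 mult_le_0_iff)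
    qed
    have "H w z = H z w" by (rule hankel_sym[OF hk that(2,1)])
    then show ?thesis using that lt[of z w] lt[of w z] by (cases z w rule: linorder_cases) auto
  qed
  have diag: "H w w = 0" if z: "z \<in> X" "H z z = 0" and w: "w \<in> X" for z w
  proof -
    \<comment> \<open>A zero at \<open>z\<close> propagates to the midpoint of \<open>z\<close> and \<open>w\<close>; iterate towards \<open>w\<close>.\<close>
    define c where "c = (\<lambda>n. w + (z - w) * (1 / 2) ^ n)"
    have "c n \<in> X \<and> H (c n) (c n) = 0" for n
    proof (induction n)
      case 0
      then show ?case using z by (simp add: c_def)
    next
      case (Suc n)
      have eq: "c (Suc n) = (c n + w) / 2" by (simp add: c_def field_simps)
      show ?case unfolding eq using Suc mid[of "c n" w] zero[of "c n" w] Hmid[of "c n" w] w by simp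
    qed
    note cn = this
    have "c \<longlonglongrightarrow> w + (z - w) * 0"
      unfolding c_def by (intro tendsto_intros LIMSEQ_power_zero) auto
    then have "c \<longlonglongrightarrow> w" by simp
    then have "(\<lambda>n. case (c n, c n) of (u, v) \<Rightarrow> H u v) \<longlonglongrightarrow> (case (w, w) of (u, v) \<Rightarrow> H u v)"
      by (intro continuous_on_tendsto_compose[OF cont[unfolded kernel_continuous_def]] tendsto_Pair)
        (use w cn in auto)
    then show ?thesis using cn by (simp add: LIMSEQ_const_iff)
  qed
  show ?thesis
  proof (rule disjCI)
    assume "\<not> (\<forall>x\<in>X. \<forall>y\<in>X. 0 < H x y)"
    then obtain x y where "x \<in> X" "y \<in> X" "H x y = 0"
      using nonneg by (metis less_eq_real_def)
    then have z: "(x + y) / 2 \<in> X" "H ((x + y) / 2) ((x + y) / 2) = 0"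
      using Hmid[of x y] mid[of x y] by simp_all
    show "\<forall>x\<in>X. \<forall>y\<in>X. H x y = 0"
    proof (intro ballI)
      fix u v assume uv: "u \<in> X" "v \<in> X"
      show "H u v = 0" using Hmid[OF uv] diag[OF z mid[OF uv]] by simp
    qed
  qed
qed

theorem TN_kernel_kpow:
  assumes p: "2 \<le> p" and \<alpha>: "(\<exists>n::nat. \<alpha> = real n) \<or> real p - 2 \<le> \<alpha>"
    and X: "pos_interval X" and cont: "kernel_continuous X H"
    and TN: "TN_kernel p X X H" and hk: "hankel X H"
  shows "TN_kernel p X X (kpow H \<alpha>)"
  using hankel_zero_or_pos[OF p X cont TN hk]
proof
  assume z: "\<forall>x\<in>X. \<forall>y\<in>X. H x y = 0"
  \<comment> \<open>Also for \<open>\<alpha> = 0\<close> the entries stay zero, by the convention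
    for 0 to the power 0.\<close>
  have "fdet r (\<lambda>i j. kpow H \<alpha> (x i) (y j)) = 0"
    if "1 \<le> r" "x \<in> inc X r" "y \<in> inc X r" for r x y
  proof -
    have "fdet r (\<lambda>i j. kpow H \<alpha> (x i) (y j)) = fdet r (\<lambda>i j. 0)"
      by (rule fdet_cong) (use z that in \<open>auto simp: kpow_def inc_iff\<close>)
    then show ?thesis using that(1) by (cases r) (simp_all add: fdet_expand)
  qed
  then show ?thesis unfolding TN_kernel_iff by auto
next
  assume pos: "\<forall>x\<in>X. \<forall>y\<in>X. 0 < H x y"
  show ?thesis
  proof (rule TN_kernel_of_psd[OF X])
    have "continuous_on (X \<times> X) (\<lambda>q. (case q of (x, y) \<Rightarrow> H x y) powr \<alpha>)"
    proof (rule continuous_on_powr[OF cont[unfolded kernel_continuous_def] continuous_on_const])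
      show "\<forall>q\<in>X \<times> X. (case q of (x, y) \<Rightarrow> H x y) \<noteq> 0"
      proof (intro ballI, elim SigmaE)
        fix q x y assume "x \<in> X" "y \<in> X" "q = (x, y)"
        then show "(case q of (x, y) \<Rightarrow> H x y) \<noteq> 0"
          using pos by (metis case_prod_conv less_irrefl)
      qed
    qed
    then show "kernel_continuous X (kpow H \<alpha>)"
      unfolding kernel_continuous_def kpow_def case_prod_unfold .
    show "hankel X (kpow H \<alpha>)"
    proof -
      obtain f where "\<forall>x\<in>X. \<forall>y\<in>X. H x y = f (x + y)" using hk unfolding hankel_def by blast
      then show ?thesis
        unfolding hankel_def kpow_def by (intro exI[of _ "\<lambda>t. f t powr \<alpha>"]) simp
    qed
    fix r x assume r: "r \<le> p" and x: "x \<in> inc X r"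
    have psd: "psd r (\<lambda>i j. H (x i) (x j))"
      by (rule psd_of_TN_kernel[OF TN hk r x])
    have pos': "0 < H (x i) (x j)" if "i < r" "j < r" for i j
      using pos x that by (simp add: inc_iff)
    show "psd r (\<lambda>i j. kpow H \<alpha> (x i) (x j))"
      using \<alpha>
    proof
      assume "\<exists>n::nat. \<alpha> = real n"
      then obtain n :: nat where n: "\<alpha> = real n" by blast
      have "psd r (\<lambda>i j. H (x i) (x j) ^ n)" by (rule psd_power[OF psd])
      then show ?thesis
        by (subst psd_cong[where B = "\<lambda>i j. H (x i) (x j) ^ n"])
          (use pos' in \<open>auto simp: kpow_def n powr_realpow\<close>)
    next
      assume "real p - 2 \<le> \<alpha>"
      then show ?thesis
        unfolding kpow_def by (intro fitzgerald_horn[OF psd pos']) (use r in auto)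
    qed
  qed
qed

subsection \<open>The critical exponent\<close>

lemma Hu_exp: "0 < u \<Longrightarrow> Hu c u x y = 1 + c * exp (ln u * (x + y))"
  by (simp add: Hu_def powr_def mult.commute)

lemma kernel_continuous_Hu: "0 < u \<Longrightarrow> kernel_continuous X (Hu c u)"
  unfolding kernel_continuous_def case_prod_unfold
  by (simp add: Hu_exp) (intro continuous_intros)

lemma hankel_Hu: "hankel X (Hu c u)"
  unfolding hankel_def Hu_def by (rule exI[of _ "\<lambda>t. 1 + c * u powr t"]) simp

text \<open>Since \<open>u powr (x + y)\<close> factors, the kernel is a sum of two rank one kernels
  with positive coefficients.\<close>

lemma TN_kernel_Hu:
  assumes "0 < c" "0 < u" "pos_interval X"
  shows "TN_kernel p X X (Hu c u)"
proof (rule TN_kernel_of_psd[OF assms(3) kernel_continuous_Hu[OF assms(2)] hankel_Hu])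
  fix r x
  have "psd r (\<lambda>i j. 1 * 1 + c * (u powr x i * u powr x j))"
    using assms by (intro psd_add psd_mult_const psd_rank_one) auto
  then show "psd r (\<lambda>i j. Hu c u (x i) (x j))"
    by (simp add: Hu_def powr_add)
qed

text \<open>The rate is \<open>s = ln u\<close>, nonzero because
  \<open>u \<noteq> 1\<close>.\<close>

lemma jain_determinant_Hu:
  assumes "0 < c" "0 < u" "u \<noteq> 1" "x \<in> inc X r" "y \<in> inc X r" "0 < \<sigma> * jain_sign r \<alpha>"
  shows "0 < \<sigma> * fdet r (\<lambda>i j. kpow (Hu c u) \<alpha> (x i) (y j))"
  using jain_determinant[of c "ln u" r x y \<sigma> \<alpha>] assms by (simp add: kpow_def Hu_exp inc_iff)

section \<open>Minors of matrices sampled from a kernel\<close>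

lemma minor_kmat:
  assumes "I \<in> inc_idx p r" "J \<in> inc_idx p r"
  shows "minor (kmat K p x y) r I J = fdet r (\<lambda>i j. K (x (I i)) (y (J j)))"
  unfolding minor_def fdet_def[symmetric]
  by (rule fdet_cong) (use assms in \<open>auto simp: kmat_def inc_idx_def\<close>)

lemma TN_mat_kmat:
  assumes "TN_kernel p X Y K" "x \<in> inc X p" "y \<in> inc Y p"
  shows "TN_mat (kmat K p x y)"
  unfolding TN_mat_def
proof (intro allI impI ballI)
  fix r I J assume r: "1 \<le> r" and "I \<in> inc_idx (dim_row (kmat K p x y)) r" "J \<in> inc_idx (dim_col (kmat K p x y)) r"
  then have I: "I \<in> inc_idx p r" and J: "J \<in> inc_idx p r" by (simp_all add: kmat_def)
  have I': "strict_mono_on {..<r} I" "\<And>i. i < r \<Longrightarrow> I i < p"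
    and J': "strict_mono_on {..<r} J" "\<And>i. i < r \<Longrightarrow> J i < p"
    using I J by (auto simp: inc_idx_def strict_mono_on_def)
  have "(\<lambda>i. x (I i)) \<in> inc X r" "(\<lambda>i. y (J i)) \<in> inc Y r"
    using inc_comp[OF assms(2) I'] inc_comp[OF assms(3) J'] by blast+
  then show "0 \<le> minor (kmat K p x y) r I J"
    unfolding minor_kmat[OF I J]
    using assms(1) r strict_mono_on_bounded_le[OF I'] unfolding TN_kernel_iff by auto
qed

lemma TP_mat_Hu:
  assumes cu: "0 < c" "0 < u" "u \<noteq> 1" and "x \<in> inc X p" "y \<in> inc X p" "real p - 2 < \<alpha>"
  shows "TP_mat (kmat (kpow (Hu c u) \<alpha>) p x y)"
  unfolding TP_mat_def
proof (intro allI impI ballI)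
  let ?A = "kmat (kpow (Hu c u) \<alpha>) p x y"
  fix r I J assume "I \<in> inc_idx (dim_row ?A) r" "J \<in> inc_idx (dim_col ?A) r"
  then have I: "I \<in> inc_idx p r" and J: "J \<in> inc_idx p r" by (simp_all add: kmat_def)
  have I': "strict_mono_on {..<r} I" "\<And>i. i < r \<Longrightarrow> I i < p"
    and J': "strict_mono_on {..<r} J" "\<And>i. i < r \<Longrightarrow> J i < p"
    using I J by (auto simp: inc_idx_def strict_mono_on_def)
  have "0 < 1 * fdet r (\<lambda>i j. kpow (Hu c u) \<alpha> (x (I i)) (y (J j)))"
  proof (rule jain_determinant_Hu[OF cu inc_comp[OF assms(4) I'] inc_comp[OF assms(5) J']])
    show "0 < 1 * jain_sign r \<alpha>"
      using strict_mono_on_bounded_le[OF I'] assms(6) jain_sign_pos[of r \<alpha>] by simp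
  qed
  then show "0 < minor ?A r I J"
    unfolding minor_kmat[OF I J] by simp
qed

lemma not_TN_mat_Hu:
  assumes cu: "0 < c" "0 < u" "u \<noteq> 1" and xy: "x \<in> inc X p" "y \<in> inc X p"
    and \<alpha>: "0 < \<alpha>" "\<alpha> < real p - 2" "\<alpha> \<notin> \<int>"
  shows "\<not> TN_mat (kmat (kpow (Hu c u) \<alpha>) p x y)"
proof
  let ?A = "kmat (kpow (Hu c u) \<alpha>) p x y"
  \<comment> \<open>The order for which \<open>\<alpha>\<close> lies strictly between
    \<open>r - 3\<close> and \<open>r - 2\<close>, so that \<open>jain_sign r \<alpha>\<close> is
    negative; \<open>\<alpha> < p - 2\<close> ensures \<open>r \<le> p\<close>.\<close>
  define r where "r = nat \<lfloor>\<alpha>\<rfloor> + 3"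
  have "of_int \<lfloor>\<alpha>\<rfloor> \<noteq> \<alpha>" using \<alpha>(3) by (metis Ints_of_int)
  then have fl: "of_int \<lfloor>\<alpha>\<rfloor> < \<alpha>" using of_int_floor_le[of \<alpha>] by linarith
  have r: "real r - 3 < \<alpha>" "\<alpha> < real r - 2" "2 \<le> r"
    using fl \<alpha>(1) unfolding r_def by linarith+
  have rp: "r \<le> p" using \<alpha>(1,2) r(1) by linarith
  have I: "(\<lambda>i. i) \<in> inc_idx p r" using rp by (simp add: inc_idx_def)
  have "x \<in> inc X r" "y \<in> inc X r" using xy rp by (auto simp: inc_def)
  then have "0 < (-1) * fdet r (\<lambda>i j. kpow (Hu c u) \<alpha> (x i) (y j))"
    by (rule jain_determinant_Hu[OF cu]) (use jain_sign_neg[OF r(3,1,2)] in simp)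
  then have "minor ?A r (\<lambda>i. i) (\<lambda>i. i) < 0"
    unfolding minor_kmat[OF I I] by simp
  moreover assume "TN_mat ?A"
  then have "0 \<le> minor ?A r (\<lambda>i. i) (\<lambda>i. i)"
    unfolding TN_mat_def using I r(3) by (simp add: kmat_def)
  ultimately show False by simp
qed

text \<open>Equally spaced points do. Failure of total nonnegativity at every tuple refutes it for
  the kernel only if a tuple exists.\<close>

lemma inc_nonempty:
  assumes "pos_interval X"
  shows "inc X p \<noteq> {}"
proof -
  obtain a b where ab: "a \<in> X" "b \<in> X" "a < b" using assms unfolding pos_interval_def by blast
  have "a + (b - a) * (real i / real p) \<in> X" if "i < p" for i
  proof (rule pos_intervalD[OF assms ab(1,2)])
    show "a \<le> a + (b - a) * (real i / real p)" using ab by simp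
    have "(b - a) * (real i / real p) \<le> (b - a) * 1"
      using ab that by (intro mult_left_mono) auto
    then show "a + (b - a) * (real i / real p) \<le> b" by simp
  qed
  moreover have "strict_mono_on {..<p} (\<lambda>i. a + (b - a) * (real i / real p))"
    using ab by (auto simp: strict_mono_on_def divide_strict_right_mono)
  ultimately have "(\<lambda>i. a + (b - a) * (real i / real p)) \<in> inc X p" by (simp add: inc_iff)
  then show ?thesis by blast
qed

theorem theoremB:
  fixes p :: nat and c0 u0 \<alpha> :: real and X0 :: "real set"
  assumes "p \<ge> 2" and "c0 > 0" and "u0 > 0" and "u0 \<noteq> 1" and "\<alpha> \<ge> 0"
    and "pos_interval X0"
  defines "S1 \<equiv> (\<forall>X H. pos_interval X \<and> kernel_continuous X H \<and> TN_kernel p X X H \<and> hankel X H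
                    \<longrightarrow> TN_kernel p X X (kpow H \<alpha>))"
    and "S2 \<equiv> TN_kernel p X0 X0 (kpow (Hu c0 u0) \<alpha>)"
    and "S3 \<equiv> ((\<exists>n::nat. \<alpha> = real n) \<or> \<alpha> \<ge> real p - 2)"
  shows "(S1 \<longleftrightarrow> S2) \<and> (S2 \<longleftrightarrow> S3)
    \<and> (\<forall>n::nat. \<forall>X H. pos_interval X \<and> kernel_continuous X H \<and> TN_kernel_all X X H \<and> hankel X H
                    \<longrightarrow> TN_kernel_all X X (kpow H (real n)))
    \<and> (\<forall>x\<in>inc X0 p. \<forall>y\<in>inc X0 p.
         (\<alpha> > real p - 2 \<longrightarrow> TP_mat (kmat (kpow (Hu c0 u0) \<alpha>) p x y))
       \<and> (0 < \<alpha> \<and> \<alpha> < real p - 2 \<and> \<alpha> \<notin> \<int> \<longrightarrow> \<not> TN_mat (kmat (kpow (Hu c0 u0) \<alpha>) p x y)))"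
proof -
  note cu = assms(2-4)
  have "S3 \<Longrightarrow> S1"
    unfolding S1_def S3_def using TN_kernel_kpow[OF assms(1)] by blast
  moreover have "S1 \<Longrightarrow> S2"
    unfolding S1_def S2_def
    using TN_kernel_Hu[OF assms(2,3,6)] kernel_continuous_Hu[OF assms(3)] hankel_Hu assms(6) by blast
  moreover have "S3" if S2
  proof (rule ccontr)
    assume n: "\<not> S3"
    \<comment> \<open>A nonnegative integer is a natural number, and so is 0, so the failure of
      \<open>S3\<close> leaves a nonintegral \<open>\<alpha>\<close> strictly between 0 and
      \<open>p - 2\<close>.\<close>
    then have "\<alpha> \<notin> \<int>"
      using assms(5) unfolding S3_def by (metis Ints_cases of_int_0_le_iff of_int_of_nat_eq zero_le_imp_eq_int)
    moreover have "\<alpha> \<noteq> 0" using n unfolding S3_def by (metis of_nat_0)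
    moreover obtain x where "x \<in> inc X0 p" using inc_nonempty[OF assms(6)] by blast
    ultimately show False
      using not_TN_mat_Hu[OF cu, of x X0 p x \<alpha>] TN_mat_kmat[OF that[unfolded S2_def], of x x] n assms(5)
      unfolding S3_def by simp
  qed
  moreover have "TN_kernel_all X X (kpow H (real n))"
    if "pos_interval X" "kernel_continuous X H" "TN_kernel_all X X H" "hankel X H" for n :: nat and X H
    unfolding TN_kernel_all_def
  proof
    fix q
    \<comment> \<open>Preservation is available for orders at least 2; order \<open>q + 2\<close>
      meets this for every \<open>q\<close>.\<close>
    have "TN_kernel (q + 2) X X (kpow H (real n))"
      using TN_kernel_kpow[of "q + 2"] that unfolding TN_kernel_all_def by auto
    then show "TN_kernel q X X (kpow H (real n))" by (rule TN_kernel_mono) simp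
  qed
  moreover have "\<forall>x\<in>inc X0 p. \<forall>y\<in>inc X0 p.
         (\<alpha> > real p - 2 \<longrightarrow> TP_mat (kmat (kpow (Hu c0 u0) \<alpha>) p x y))
       \<and> (0 < \<alpha> \<and> \<alpha> < real p - 2 \<and> \<alpha> \<notin> \<int> \<longrightarrow> \<not> TN_mat (kmat (kpow (Hu c0 u0) \<alpha>) p x y))"
    using TP_mat_Hu[OF cu] not_TN_mat_Hu[OF cu] by blast
  ultimately show ?thesis by blast
qed

end
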